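(* Under the nonparametric regression model and technical assumptions below, fix $x\in\mathcal X$ and let $0<s_1<s_2=o(n)$ with $s_1,s_2\to\infty$ satisfy the bounded-ratio condition. Then the DNN estimator (of order $s=s_1$ or $s=s_2$) and the TDNN estimator satisfy the asymptotic Hájek dominance condition, i.e. $$\frac{s}{n}\left(\frac{\zeta^{s}_{s}(x)}{s\,\zeta^{1}_{s}(x)}-1\right)\to0 \quad\text{and}\quad \frac{s_2}{n}\left(\frac{\zeta^{s_2}_{\mathfrak S}(x)}{s_2\,\zeta^{1}_{\mathfrak S}(x)}-1\right)\to0 .$$
   Context: Data: $D_{[n]}=(Z_1,\dots,Z_n)$ with $Z_i=(X_i,Y_i)$ i.i.d. from the model $Y=\mu(X)+\varepsilon$, where $X\in\mathcal X\subset\mathbb R^k$ ($k$ fixed) has density $f$ and distribution $\varphi$, $\mathbb E[\varepsilon\mid X]=0$ and $\operatorname{Var}(\varepsilon\mid X=x)=\sigma^2_\varepsilon(x)$. Technical assumptions: $\mathcal X$ is a bounded compact subset of $\mathbb R^k$; $0<\underline{\mathfrak f}\le f\le\overline{\mathfrak f}<\infty$ on $\mathcal X$; $f$ and $\mu$ are four times continuously differentiable with bounded second, third and fourth order partial derivatives; $\mu\in L^2(\mathcal X,\varphi)$; $\sigma^2_\varepsilon:\mathcal X\to(0,\infty)$ is continuous, square-integrable w.r.t. $\varphi$, and bounded above by $\overline\sigma^2_\varepsilon$. For a finite data set $D$ containing $Z_i$, $\kappa(x;Z_i,D)=1$ if $X_i$ is the closest covariate in $D$ to $x$ in Euclidean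 norm, and $0$ otherwise (ties have probability zero). With $L_{n,s}$ the set of strictly increasing $s$-tuples from $\{1,\dots,n\}$ and $D_\ell$ the observations indexed by $\ell$, the DNN kernel is $h_s(x;D_\ell)=\sum_{i\in\ell}\kappa(x;Z_i,D_\ell)Y_i$ and the DNN estimator is $\tilde\mu_s(x;D_{[n]})=\binom{n}{s}^{-1}\sum_{\ell\in L_{n,s}}h_s(x;D_\ell)$. For $1\le s_1<s_2\le n$ (write $\mathfrak S=(s_1,s_2)$), let $w_1^*=1/(1-(s_1/s_2)^{-2/k})$, $w_2^*=1-w_1^*$; the TDNN estimator is $\hat\mu_{\mathfrak S}(x;D_{[n]})=w_1^*\tilde\mu_{s_1}(x;D_{[n]})+w_2^*\tilde\mu_{s_2}(x;D_{[n]})=\binom{n}{s_2}^{-1}\sum_{\ell\in L_{n,s_2}}h_{\mathfrak S}(x;D_\ell)$ with kernel $h_{\mathfrak S}(x;D_{[s_2]})=w_1^*\tilde\mu_{s_1}(x;D_{[s_2]})+w_2^*h_{s_2}(x;D_{[s_2]})$. Bounded-ratio condition: there is $\mathfrak c\in(0,1/2)$ with $\mathfrak c\le s_1/s_2\le 1-\mathfrak c$ for all $n$. For a kernel $g$ of order $m$ (here $g=h_s$ with $m=s$, or $g=h_{\mathfrak S}$ with $m=s_2$), $\zeta^1=\operatorname{Cov}(g(x;Z_1,Z_2,\dots,Z_m),g(x;Z_1,Z_2',\dots,Z_m'))$ with $Z_j'$ independent copies, and $\zeta^m=\operatorname{Var}(g(x;Z_1,\dots,Z_m))$. Limits are as $n\to\infty$.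 *)

theory Defs
  imports "HOL-Probability.Probability"
begin

definition partial_dir :: "'a::euclidean_space \<Rightarrow> ('a \<Rightarrow> real) \<Rightarrow> 'a \<Rightarrow> real" where
  "partial_dir v g = (\<lambda>x. frechet_derivative g (at x) v)"

fun iter_partial :: "'a::euclidean_space list \<Rightarrow> ('a \<Rightarrow> real) \<Rightarrow> 'a \<Rightarrow> real" where
  "iter_partial [] g = g"
| "iter_partial (v # vs) g = partial_dir v (iter_partial vs g)"

definition C4_bounded_higher :: "('a::euclidean_space \<Rightarrow> real) \<Rightarrow> bool" where
  "C4_bounded_higher g \<longleftrightarrow>
     (\<forall>vs. set vs \<subseteq> Basis \<and> length vs \<le> 3 \<longrightarrow> (\<forall>x. iter_partial vs g differentiable (at x))) \<and>
     (\<forall>vs. set vs \<subseteq> Basis \<and> length vs \<le> 4 \<longrightarrow> continuous_on UNIV (iter_partial vs g)) \<and>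
     (\<forall>vs. set vs \<subseteq> Basis \<and> 2 \<le> length vs \<and> length vs \<le> 4 \<longrightarrow> bounded (range (iter_partial vs g)))"

text \<open>Index (in the finite index set L) of the covariate closest to x; ties (a null event)
  are broken by taking the smallest index.\<close>
definition nn_index :: "'a::euclidean_space \<Rightarrow> (nat \<Rightarrow> 'a \<times> real) \<Rightarrow> nat set \<Rightarrow> nat" where
  "nn_index x z L = (LEAST i. i \<in> L \<and> (\<forall>j\<in>L. dist (fst (z i)) x \<le> dist (fst (z j)) x))"

text \<open>1-NN kernel on the subsample indexed by L: sum over i in L of kappa(x; Z_i, D_L) Y_i.\<close>
definition nn_value :: "'a::euclidean_space \<Rightarrow> (nat \<Rightarrow> 'a \<times> real) \<Rightarrow> nat set \<Rightarrow> real" where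
  "nn_value x z L = snd (z (nn_index x z L))"

definition dnn_kernel :: "nat \<Rightarrow> 'a::euclidean_space \<Rightarrow> (nat \<Rightarrow> 'a \<times> real) \<Rightarrow> real" where
  "dnn_kernel s x z = nn_value x z {0..<s}"

definition dnn_est :: "nat \<Rightarrow> nat \<Rightarrow> 'a::euclidean_space \<Rightarrow> (nat \<Rightarrow> 'a \<times> real) \<Rightarrow> real" where
  "dnn_est s m x z = (\<Sum>L \<in> {L. L \<subseteq> {0..<m} \<and> card L = s}. nn_value x z L) / real (m choose s)"

definition tdnn_w1 :: "nat \<Rightarrow> nat \<Rightarrow> nat \<Rightarrow> real" where
  "tdnn_w1 k s1 s2 = 1 / (1 - (real s1 / real s2) powr (- 2 / real k))"

definition tdnn_w2 :: "nat \<Rightarrow> nat \<Rightarrow> nat \<Rightarrow> real" where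
  "tdnn_w2 k s1 s2 = 1 - tdnn_w1 k s1 s2"

definition tdnn_kernel :: "nat \<Rightarrow> nat \<Rightarrow> 'a::euclidean_space \<Rightarrow> (nat \<Rightarrow> 'a \<times> real) \<Rightarrow> real" where
  "tdnn_kernel s1 s2 x z =
     tdnn_w1 DIM('a) s1 s2 * dnn_est s1 s2 x z + tdnn_w2 DIM('a) s1 s2 * dnn_kernel s2 x z"

text \<open>zeta^1: Cov(g(Z_1,Z_2,...,Z_m), g(Z_1,Z_2',...,Z_m')), realised on the product of 2m
  i.i.d. copies of P: the first sample uses coordinates 0..m-1, the second uses coordinate 0
  and coordinates m+1,...,2m-1.\<close>
definition zeta1 :: "('a \<times> real) measure \<Rightarrow> nat \<Rightarrow> ((nat \<Rightarrow> 'a \<times> real) \<Rightarrow> real) \<Rightarrow> real" where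
  "zeta1 P m g =
    (let Q = PiM {0..<2*m} (\<lambda>_. P);
         A = (\<lambda>\<omega>. g \<omega>);
         B = (\<lambda>\<omega>. g (\<lambda>i. if i = 0 then \<omega> 0 else \<omega> (m + i)));
         EA = integral\<^sup>L Q A;
         EB = integral\<^sup>L Q B
     in integral\<^sup>L Q (\<lambda>\<omega>. (A \<omega> - EA) * (B \<omega> - EB)))"

definition zetam :: "('a \<times> real) measure \<Rightarrow> nat \<Rightarrow> ((nat \<Rightarrow> 'a \<times> real) \<Rightarrow> real) \<Rightarrow> real" where
  "zetam P m g =
    (let Q = PiM {0..<m} (\<lambda>_. P); E = integral\<^sup>L Q g
     in integral\<^sup>L Q (\<lambda>\<omega>. (g \<omega> - E)\<^sup>2))"

end

theory Submission
  imports Defs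
begin

text \<open>
  Both kernels are linear combinations of 1-NN values over subsamples, so their variance is at most
  \<open>(\<Sum> |weights|)\<^sup>2\<close> times a bound on \<open>E[Y\<^sup>2 | X]\<close>, which is uniform in the
  subsampling sizes. It remains to bound \<open>m \<zeta>\<^sup>1\<close> away from 0, where \<open>m\<close> is the order of the kernel.

  \<open>\<zeta>\<^sup>1\<close> is the variance of the projection of the kernel on the first observation \<open>(X, Y)\<close>. Given \<open>X\<close>,
  this projection is affine in \<open>Y\<close>, with a slope that is a polynomial in
  \<open>U = P(another covariate is at least as far from x as X)\<close>. The noise alone therefore contributes
  at least \<open>min \<sigma>\<^sup>2 \<cdot> E[slope\<^sup>2]\<close>. As \<open>X\<close> has a density, \<open>U\<close> is uniform on \<open>[0, 1]\<close>, and
  \<open>slope\<^sup>2 \<ge> 2 slope U\<^sup>m - U\<^sup>2\<^sup>m\<close> gives \<open>E[slope\<^sup>2] \<ge> 1 / (2m)\<close>: for the two-scale kernel the weight of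
  the smaller scale is nonpositive and multiplies a moment that is at most the one of the larger scale.
\<close>

subsection \<open>Nearest-neighbour values and their linear combinations\<close>

text \<open>Fubini with the distinguished coordinate outermost: the inner integral is then a
  conditional expectation given observation \<open>i\<close>, the form in which projections on one
  observation arise.\<close>

lemma (in product_sigma_finite) product_integral_insert_rev:
  fixes f :: "_ \<Rightarrow> _::{banach, second_countable_topology}"
  assumes I: "finite I" "i \<notin> I"
    and f: "integrable (Pi\<^sub>M (insert i I) M) f"
  shows "integral\<^sup>L (Pi\<^sub>M (insert i I) M) f = (\<integral>z. (\<integral>w. f (w(i := z)) \<partial>Pi\<^sub>M I M) \<partial>M i)"
proof -
  interpret I: finite_product_sigma_finite M I by standard fact
  have [measurable]: "f \<in> borel_measurable (Pi\<^sub>M (insert i I) M)"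
    using f by auto
  have [measurable]: "(\<lambda>z. \<integral>w. f (w(i := z)) \<partial>Pi\<^sub>M I M) \<in> borel_measurable (M i)"
    by (rule I.borel_measurable_lebesgue_integral) measurable
  have "integral\<^sup>L (Pi\<^sub>M ({i} \<union> I) M) f =
      (\<integral>y. (\<integral>w. f (merge {i} I (y, w)) \<partial>Pi\<^sub>M I M) \<partial>Pi\<^sub>M {i} M)"
    using I f by (intro product_integral_fold) auto
  \<comment> \<open>Points of a product space are \<open>undefined\<close> off their index set, so
    on these spaces \<open>merge\<close> agrees with a function update.\<close>
  also have "\<dots> = (\<integral>y. (\<integral>w. f (w(i := y i)) \<partial>Pi\<^sub>M I M) \<partial>Pi\<^sub>M {i} M)"
    using I
    by (auto intro!: Bochner_Integration.integral_cong arg_cong[where f = f]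
        simp: merge_def space_PiM extensional_def PiE_def fun_eq_iff)
  also have "\<dots> = (\<integral>z. (\<integral>w. f (w(i := z)) \<partial>Pi\<^sub>M I M) \<partial>M i)"
    by (rule product_integral_singleton) measurable
  finally show ?thesis by simp
qed

section \<open>Products and sums of square-integrable functions\<close>

lemma integrable_mult_of_squares:
  fixes f g :: "'b \<Rightarrow> real"
  assumes [measurable]: "f \<in> borel_measurable N" "g \<in> borel_measurable N"
    and "integrable N (\<lambda>z. (f z)\<^sup>2)" "integrable N (\<lambda>z. (g z)\<^sup>2)"
  shows "integrable N (\<lambda>z. f z * g z)"
proof (rule Bochner_Integration.integrable_bound)
  show "integrable N (\<lambda>z. (f z)\<^sup>2 + (g z)\<^sup>2)"
    using assms by simp
  show "AE z in N. norm (f z * g z) \<le> norm ((f z)\<^sup>2 + (g z)\<^sup>2)"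
  proof (rule AE_I2)
    fix z
    have "0 \<le> (\<bar>f z\<bar> - \<bar>g z\<bar>)\<^sup>2 + \<bar>f z\<bar> * \<bar>g z\<bar>"
      by simp
    then show "norm (f z * g z) \<le> norm ((f z)\<^sup>2 + (g z)\<^sup>2)"
      by (simp add: power2_diff abs_mult)
  qed
qed measurable

lemma integrable_add_square:
  fixes f g :: "'b \<Rightarrow> real"
  assumes "f \<in> borel_measurable N" "g \<in> borel_measurable N"
    and "integrable N (\<lambda>z. (f z)\<^sup>2)" "integrable N (\<lambda>z. (g z)\<^sup>2)"
  shows "integrable N (\<lambda>z. (f z + g z)\<^sup>2)"
  using assms integrable_mult_of_squares[OF assms]
  by (simp add: power2_sum mult.assoc)

section \<open>Dependence of the nearest neighbour on covariates and responses\<close>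

lemma nn_index_nearest:
  assumes "finite L" "L \<noteq> {}"
  shows "nn_index x z L \<in> L \<and> (\<forall>j\<in>L. dist (fst (z (nn_index x z L))) x \<le> dist (fst (z j)) x)"
proof -
  obtain i where "i \<in> L" "\<forall>j\<in>L. dist (fst (z i)) x \<le> dist (fst (z j)) x"
    using ex_is_arg_min_if_finite[OF assms, of "\<lambda>i. dist (fst (z i)) x"]
    by (auto simp: is_arg_min_linorder)
  then have "i \<in> L \<and> (\<forall>j\<in>L. dist (fst (z i)) x \<le> dist (fst (z j)) x)"
    by blast
  then show ?thesis
    unfolding nn_index_def by (rule LeastI)
qed

text \<open>Only covariates enter the search for a neighbour, so responses can be altered without
  moving the selected index.\<close>

lemma nn_index_cong:
  assumes "\<And>i. i \<in> L \<Longrightarrow> fst (z i) = fst (z' i)"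
  shows "nn_index x z L = nn_index x z' L"
proof -
  have "i \<in> L \<and> (\<forall>j\<in>L. dist (fst (z i)) x \<le> dist (fst (z j)) x) \<longleftrightarrow>
      i \<in> L \<and> (\<forall>j\<in>L. dist (fst (z' i)) x \<le> dist (fst (z' j)) x)" for i
    using assms by auto
  then show ?thesis
    unfolding nn_index_def by presburger
qed

lemma nn_value_cong:
  assumes "finite L" "L \<noteq> {}" "\<And>i. i \<in> L \<Longrightarrow> z i = z' i"
  shows "nn_value x z L = nn_value x z' L"
  using nn_index_nearest[OF assms(1,2), of x z'] nn_index_cong[of L z z' x] assms(3)
  by (simp add: nn_value_def)

text \<open>The tie-breaking rule of \<^const>\<open>nn_index\<close> favours the index 0, so no strict inequality
  occurs here.\<close>
lemma nn_index_eq_0_iff: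
  assumes "finite L" "L \<noteq> {}"
  shows "nn_index x z L = 0 \<longleftrightarrow> 0 \<in> L \<and> (\<forall>j\<in>L. dist (fst (z 0)) x \<le> dist (fst (z j)) x)"
proof
  show "nn_index x z L = 0 \<Longrightarrow> 0 \<in> L \<and> (\<forall>j\<in>L. dist (fst (z 0)) x \<le> dist (fst (z j)) x)"
    using nn_index_nearest[OF assms, of x z] by auto
  show "0 \<in> L \<and> (\<forall>j\<in>L. dist (fst (z 0)) x \<le> dist (fst (z j)) x) \<Longrightarrow> nn_index x z L = 0"
    unfolding nn_index_def by (rule Least_eq_0)
qed

text \<open>The selected index ignores the response \<open>y\<close>, which therefore enters
  linearly, and only on the event that observation 0 is selected.\<close>

lemma nn_value_upd_0:
  assumes "finite L" "L \<noteq> {}"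
  shows "nn_value x (w(0 := (u, y))) L =
    nn_value x (w(0 := (u, 0))) L + y * of_bool (nn_index x (w(0 := (u, 0))) L = 0)"
proof -
  have "nn_index x (w(0 := (u, y))) L = nn_index x (w(0 := (u, 0))) L"
    by (rule nn_index_cong) auto
  then show ?thesis by (simp add: nn_value_def)
qed

text \<open>Evaluation at a random index becomes a finite sum over fixed indices, from which
  measurability can be read off.\<close>

lemma nn_value_eq_sum:
  assumes "finite L" "L \<noteq> {}"
  shows "nn_value x z L = (\<Sum>i\<in>L. of_bool (nn_index x z L = i) * snd (z i))"
proof -
  have "(\<Sum>i\<in>L. of_bool (nn_index x z L = i) * snd (z i)) =
      (\<Sum>i\<in>L. if i = nn_index x z L then snd (z i) else 0)"
    by (intro sum.cong) auto
  then show ?thesis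
    using nn_index_nearest[OF assms, of x z] assms by (simp add: nn_value_def)
qed

text \<open>The selection events are disjoint, so squaring creates no cross terms.\<close>

lemma nn_value_square_eq_sum:
  assumes "finite L" "L \<noteq> {}"
  shows "(nn_value x z L)\<^sup>2 = (\<Sum>i\<in>L. of_bool (nn_index x z L = i) * (snd (z i))\<^sup>2)"
proof -
  have "(\<Sum>i\<in>L. of_bool (nn_index x z L = i) * (snd (z i))\<^sup>2) =
      (\<Sum>i\<in>L. if i = nn_index x z L then (snd (z i))\<^sup>2 else 0)"
    by (intro sum.cong) auto
  then show ?thesis
    using nn_index_nearest[OF assms, of x z] assms by (simp add: nn_value_def)
qed

text \<open>A common form for both kernels, so that each estimate is proved once for arbitrary
  weights on subsamples. The empty subsample is left out because it has no nearest
  neighbour.\<close>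

definition lin_kernel :: "(nat set \<Rightarrow> real) \<Rightarrow> nat \<Rightarrow> 'a::euclidean_space \<Rightarrow> (nat \<Rightarrow> 'a \<times> real) \<Rightarrow> real" where
  "lin_kernel W m x z = (\<Sum>L\<in>Pow {0..<m} - {{}}. W L * nn_value x z L)"

abbreviation total_weight :: "(nat set \<Rightarrow> real) \<Rightarrow> nat \<Rightarrow> real" where
  "total_weight W m \<equiv> (\<Sum>L\<in>Pow {0..<m} - {{}}. \<bar>W L\<bar>)"

lemma lin_kernel_cong:
  assumes "\<And>i. i < m \<Longrightarrow> z i = z' i"
  shows "lin_kernel W m x z = lin_kernel W m x z'"
  unfolding lin_kernel_def
proof (intro sum.cong refl arg_cong2[where f = "(*)"])
  fix L assume "L \<in> Pow {0..<m} - {{}}"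
  then show "nn_value x z L = nn_value x z' L"
    using assms by (intro nn_value_cong) (auto intro: finite_subset)
qed

lemma abs_nn_value_le:
  assumes "finite I" "L \<subseteq> I" "L \<noteq> {}"
  shows "\<bar>nn_value x z L\<bar> \<le> (\<Sum>i\<in>I. \<bar>snd (z i)\<bar>)"
proof -
  have "nn_index x z L \<in> I"
    using nn_index_nearest[of L x z] assms finite_subset by blast
  then show ?thesis
    unfolding nn_value_def using assms(1)
    by (intro member_le_sum[where f = "\<lambda>i. \<bar>snd (z i)\<bar>"]) auto
qed

text \<open>This crude bound grows with \<open>m\<close> and serves integrability; the variance
  bound rests on \<open>lin_kernel_square_le\<close>.\<close>

lemma abs_lin_kernel_le:
  "\<bar>lin_kernel W m x z\<bar> \<le> total_weight W m * (\<Sum>i\<in>{0..<m}. \<bar>snd (z i)\<bar>)"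
proof -
  have "\<bar>lin_kernel W m x z\<bar> \<le> (\<Sum>L\<in>Pow {0..<m} - {{}}. \<bar>W L\<bar> * \<bar>nn_value x z L\<bar>)"
    unfolding lin_kernel_def by (rule order_trans[OF sum_abs]) (simp add: abs_mult)
  also have "\<dots> \<le> (\<Sum>L\<in>Pow {0..<m} - {{}}. \<bar>W L\<bar> * (\<Sum>i\<in>{0..<m}. \<bar>snd (z i)\<bar>))"
    by (intro sum_mono mult_left_mono abs_nn_value_le) auto
  finally show ?thesis by (simp add: sum_distrib_right)
qed

text \<open>Cauchy-Schwarz with each absolute weight split into two square roots. The number of
  subsamples then enters only through the total weight.\<close>

lemma lin_kernel_square_le:
  "(lin_kernel W m x z)\<^sup>2 \<le>
    total_weight W m * (\<Sum>L\<in>Pow {0..<m} - {{}}. \<bar>W L\<bar> * (nn_value x z L)\<^sup>2)"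
proof -
  have eq: "W L * nn_value x z L = sqrt \<bar>W L\<bar> * (sgn (W L) * sqrt \<bar>W L\<bar> * nn_value x z L)" for L
    by (auto simp: sgn_if mult.assoc[symmetric])
  have sq: "(sgn (W L) * sqrt \<bar>W L\<bar> * nn_value x z L)\<^sup>2 = \<bar>W L\<bar> * (nn_value x z L)\<^sup>2" for L
    by (auto simp: power_mult_distrib sgn_if)
  have "(lin_kernel W m x z)\<^sup>2 \<le> (\<Sum>L\<in>Pow {0..<m} - {{}}. (sqrt \<bar>W L\<bar>)\<^sup>2) *
      (\<Sum>L\<in>Pow {0..<m} - {{}}. (sgn (W L) * sqrt \<bar>W L\<bar> * nn_value x z L)\<^sup>2)"
    unfolding lin_kernel_def by (subst eq) (rule Cauchy_Schwarz_ineq_sum)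
  then show ?thesis by (simp add: sq)
qed

subsection \<open>Square integrability over product laws\<close>

lemma measurable_pred_le_real [measurable (raw)]:
  fixes f g :: "'b \<Rightarrow> real"
  assumes [measurable]: "f \<in> borel_measurable N" "g \<in> borel_measurable N"
  shows "Measurable.pred N (\<lambda>w. f w \<le> g w)"
  unfolding not_less[symmetric] by measurable

text \<open>Conditional statements about the response are encoded by testing against functions of
  the covariate: \<open>second_moment\<close> bounds the conditional second moment by
  \<open>M\<close>, \<open>noise_variance\<close> bounds the conditional variance below by
  \<open>v\<close>, and \<open>noise_centered\<close> is conditional centring. Since
  \<open>h\<close> is \<open>ennreal\<close>-valued and a non-integrable Bochner integral is 0, the
  test functions need only be measurable.\<close>

locale regression_law = prob_space P
  for P :: "('a::euclidean_space \<times> real) measure" +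
  fixes x :: 'a and \<mu> :: "'a \<Rightarrow> real" and M v :: real
  assumes sets_P: "sets P = sets borel"
    and \<mu>_measurable [measurable]: "\<mu> \<in> borel_measurable borel"
    and \<mu>_square: "integrable P (\<lambda>z. (\<mu> (fst z))\<^sup>2)"
    and no_ties: "emeasure P {z. dist (fst z) x = r} = 0"
    and second_moment: "h \<in> borel_measurable borel \<Longrightarrow>
      (\<integral>\<^sup>+ z. ennreal ((snd z)\<^sup>2) * h (fst z) \<partial>P) \<le> ennreal M * (\<integral>\<^sup>+ z. h (fst z) \<partial>P)"
    and noise_variance: "h \<in> borel_measurable borel \<Longrightarrow>
      ennreal v * (\<integral>\<^sup>+ z. h (fst z) \<partial>P) \<le> (\<integral>\<^sup>+ z. ennreal ((snd z - \<mu> (fst z))\<^sup>2) * h (fst z) \<partial>P)"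
    and noise_centered: "k \<in> borel_measurable borel \<Longrightarrow>
      (\<integral>z. k (fst z) * (snd z - \<mu> (fst z)) \<partial>P) = 0"
    and M_nonneg: "0 \<le> M" and v_pos: "0 < v"
begin

lemma sets_P_pair [measurable_cong]: "sets P = sets (borel \<Otimes>\<^sub>M borel)"
  unfolding sets_P by (rule arg_cong[where f = sets, OF borel_prod[symmetric]])

lemma space_P [simp]: "space P = UNIV"
  using sets_eq_imp_space_eq[OF sets_P] by simp

sublocale product_sigma_finite "\<lambda>_::nat. P"
  by (rule product_sigma_finite.intro) (rule sigma_finite_measure_axioms)

abbreviation prod_law :: "nat set \<Rightarrow> (nat \<Rightarrow> 'a \<times> real) measure" where
  "prod_law I \<equiv> PiM I (\<lambda>_. P)"

lemma prob_space_prod_law: "prob_space (prod_law I)"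
  by (intro prob_space_PiM prob_space_axioms)

lemma measurable_nn_index [measurable (raw)]:
  assumes "L \<subseteq> I"
  shows "(\<lambda>w. nn_index x w L) \<in> measurable (prod_law I) (count_space UNIV)"
  unfolding nn_index_def
proof (rule measurable_Least)
  fix i
  show "Measurable.pred (prod_law I) (\<lambda>w. i \<in> L \<and> (\<forall>j\<in>L. dist (fst (w i)) x \<le> dist (fst (w j)) x))"
  proof (cases "i \<in> L")
    case True
    with assms have [measurable]: "i \<in> I" by auto
    have "Measurable.pred (prod_law I) (\<lambda>w. dist (fst (w i)) x \<le> dist (fst (w j)) x)" if "j \<in> L" for j
    proof -
      have [measurable]: "j \<in> I" using that assms by auto
      show ?thesis by measurable
    qed
    then have "Measurable.pred (prod_law I) (\<lambda>w. \<forall>j\<in>L. dist (fst (w i)) x \<le> dist (fst (w j)) x)"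
      by (intro pred_intros_countable_bounded) auto
    then show ?thesis using True by simp
  qed simp
qed

lemma measurable_nn_value:
  assumes "finite L" "L \<noteq> {}" "L \<subseteq> I"
  shows "(\<lambda>w. nn_value x w L) \<in> borel_measurable (prod_law I)"
proof -
  note measurable_nn_index[OF assms(3), measurable]
  have "(\<lambda>w. \<Sum>i\<in>L. of_bool (nn_index x w L = i) * snd (w i)) \<in> borel_measurable (prod_law I)"
  proof (intro borel_measurable_sum)
    fix i assume "i \<in> L"
    then have [measurable]: "i \<in> I" using assms by auto
    show "(\<lambda>w. of_bool (nn_index x w L = i) * snd (w i)) \<in> borel_measurable (prod_law I)"
      by measurable
  qed
  then show ?thesis by (simp add: nn_value_eq_sum[OF assms(1,2)])
qed

lemma measurable_lin_kernel [measurable]: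
  "lin_kernel W m x \<in> borel_measurable (prod_law {0..<m})"
  unfolding lin_kernel_def[abs_def]
  by (intro borel_measurable_sum borel_measurable_times borel_measurable_const measurable_nn_value)
    (auto intro: finite_subset)

lemma response_square_integrable: "integrable P (\<lambda>z. (snd z)\<^sup>2)"
proof (rule integrableI_bounded)
  have "(\<integral>\<^sup>+ z. ennreal (norm ((snd z)\<^sup>2)) \<partial>P) \<le> ennreal M"
    using second_moment[of "\<lambda>_. 1"] by (simp add: emeasure_space_1[simplified])
  then show "(\<integral>\<^sup>+ z. ennreal (norm ((snd z)\<^sup>2)) \<partial>P) < \<infinity>"
    by (auto simp: top.extremum_strict intro: le_less_trans)
qed measurable

lemma component_square_integrable:
  assumes "i \<in> I"
  shows "integrable (prod_law I) (\<lambda>w. (snd (w i))\<^sup>2)"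
proof -
  have "distr (prod_law I) P (\<lambda>w. w i) = P"
    using assms by (intro distr_PiM_component prob_space_axioms)
  moreover have "integrable (distr (prod_law I) P (\<lambda>w. w i)) (\<lambda>z. (snd z)\<^sup>2) \<longleftrightarrow>
      integrable (prod_law I) (\<lambda>w. (snd (w i))\<^sup>2)"
    using assms by (intro integrable_distr_eq) measurable
  ultimately show ?thesis
    using response_square_integrable by metis
qed

text \<open>Linear growth in the responses suffices. The constant \<open>b\<close> makes room for a
  frozen first response when this is applied to an updated kernel.\<close>

lemma dominated_square_integrable:
  assumes [measurable]: "g \<in> borel_measurable (prod_law I)" and "finite I"
    and bound: "\<And>w. \<bar>g w\<bar> \<le> C * (b + (\<Sum>i\<in>I. \<bar>snd (w i)\<bar>))"
  shows "integrable (prod_law I) (\<lambda>w. (g w)\<^sup>2)"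
proof (rule Bochner_Integration.integrable_bound)
  interpret Q: prob_space "prod_law I" by (rule prob_space_prod_law)
  let ?s = "\<lambda>w. \<Sum>i\<in>I. \<bar>snd (w i :: 'a \<times> real)\<bar>"
  have [measurable]: "?s \<in> borel_measurable (prod_law I)"
    by measurable
  have "integrable (prod_law I) (\<lambda>w. (?s w)\<^sup>2)"
  proof (rule Bochner_Integration.integrable_bound)
    show "integrable (prod_law I) (\<lambda>w. (\<Sum>i\<in>I. (snd (w i))\<^sup>2) * real (card I))"
      by (intro integrable_mult_left Bochner_Integration.integrable_sum component_square_integrable)
    show "AE w in prod_law I. norm ((?s w)\<^sup>2) \<le> norm ((\<Sum>i\<in>I. (snd (w i))\<^sup>2) * real (card I))"
    proof (rule AE_I2)
      fix w
      have "(?s w)\<^sup>2 \<le> (\<Sum>i\<in>I. \<bar>snd (w i)\<bar>\<^sup>2) * real (card I)"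
        by (rule sum_squared_le_sum_of_squares)
      then show "norm ((?s w)\<^sup>2) \<le> norm ((\<Sum>i\<in>I. (snd (w i))\<^sup>2) * real (card I))"
        by (simp add: sum_nonneg)
    qed
  qed measurable
  then show "integrable (prod_law I) (\<lambda>w. C\<^sup>2 * (b + ?s w)\<^sup>2)"
    by (intro integrable_mult_right integrable_add_square) auto
  show "AE w in prod_law I. norm ((g w)\<^sup>2) \<le> norm (C\<^sup>2 * (b + ?s w)\<^sup>2)"
  proof (rule AE_I2)
    fix w
    have "\<bar>g w\<bar>\<^sup>2 \<le> (C * (b + ?s w))\<^sup>2"
      using bound by (intro power_mono) auto
    then show "norm ((g w)\<^sup>2) \<le> norm (C\<^sup>2 * (b + ?s w)\<^sup>2)"
      by (simp add: power_mult_distrib)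
  qed
qed measurable

lemma integrable_of_square_integrable:
  assumes "g \<in> borel_measurable (prod_law I)" "integrable (prod_law I) (\<lambda>w. (g w)\<^sup>2)"
  shows "integrable (prod_law I) (g :: _ \<Rightarrow> real)"
proof -
  interpret Q: prob_space "prod_law I" by (rule prob_space_prod_law)
  show ?thesis using assms by (rule Q.square_integrable_imp_integrable)
qed

lemma lin_kernel_square_integrable: "integrable (prod_law {0..<m}) (\<lambda>w. (lin_kernel W m x w)\<^sup>2)"
proof (rule dominated_square_integrable)
  show "\<bar>lin_kernel W m x w\<bar> \<le> total_weight W m * (0 + (\<Sum>i\<in>{0..<m}. \<bar>snd (w i)\<bar>))" for w
    using abs_lin_kernel_le[of W m x w] by simp
qed simp_all

lemma lin_kernel_integrable: "integrable (prod_law {0..<m}) (lin_kernel W m x)"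
  by (rule integrable_of_square_integrable[OF measurable_lin_kernel lin_kernel_square_integrable])

subsection \<open>The variance of a linear kernel\<close>

text \<open>With all other observations fixed, whether \<open>i\<close> is selected depends on
  observation \<open>i\<close> only through its covariate. The selection event is thus an admissible
  test function for \<open>second_moment\<close>.\<close>

lemma nn_integral_nearest_response_le:
  assumes "finite I" "L \<subseteq> I" "i \<in> L"
  shows "(\<integral>\<^sup>+ w. ennreal (of_bool (nn_index x w L = i) * (snd (w i))\<^sup>2) \<partial>prod_law I) \<le>
    ennreal M * (\<integral>\<^sup>+ w. ennreal (of_bool (nn_index x w L = i)) \<partial>prod_law I)"
proof -
  let ?J = "I - {i}"
  have I: "insert i ?J = I" and J: "finite ?J" "i \<notin> ?J" and [measurable]: "i \<in> I"
    using assms by auto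
  note measurable_nn_index[OF assms(2), measurable]
  have meas [measurable]: "(\<lambda>w. ennreal (of_bool (nn_index x w L = i) * (snd (w i))\<^sup>2)) \<in> borel_measurable (prod_law (insert i ?J))"
    "(\<lambda>w. ennreal (of_bool (nn_index x w L = i))) \<in> borel_measurable (prod_law (insert i ?J))"
    unfolding I by measurable
  \<comment> \<open>The response 0 is a placeholder: it turns the selection event into a function of
    the covariate alone.\<close>
  define B where "B w u = ennreal (of_bool (nn_index x (w(i := (u, 0::real))) L = i))"
    for w :: "nat \<Rightarrow> 'a \<times> real" and u
  have idx: "nn_index x (w(i := z)) L = nn_index x (w(i := (fst z, 0))) L"
    for w :: "nat \<Rightarrow> 'a \<times> real" and z
    by (rule nn_index_cong) auto
  have B: "ennreal (of_bool (nn_index x (w(i := z)) L = i)) = B w (fst z)" for w z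
    unfolding B_def by (subst idx) (rule refl)
  have B_meas: "B w \<in> borel_measurable borel" if "w \<in> space (prod_law ?J)" for w
  proof -
    have "(\<lambda>u. w(i := (u, 0::real))) \<in> measurable borel (prod_law (insert i ?J))"
      by (rule measurable_compose[OF _ measurable_component_update[OF that]]) (use J in measurable)
    from measurable_compose[OF this meas(2)] show ?thesis
      unfolding B_def[abs_def] .
  qed
  have meas': "(\<lambda>w. \<integral>\<^sup>+ z. B w (fst z) \<partial>P) \<in> borel_measurable (prod_law ?J)"
    unfolding B[symmetric] by measurable
  have "(\<integral>\<^sup>+ w. ennreal (of_bool (nn_index x w L = i) * (snd (w i))\<^sup>2) \<partial>prod_law I) =
      (\<integral>\<^sup>+ w. (\<integral>\<^sup>+ z. ennreal ((snd z)\<^sup>2) * B w (fst z) \<partial>P) \<partial>prod_law ?J)"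
    using product_nn_integral_insert[OF J meas(1)]
    unfolding I by (simp add: ennreal_mult B fun_upd_same mult.commute del: fun_upd_apply)
  also have "\<dots> \<le> (\<integral>\<^sup>+ w. ennreal M * (\<integral>\<^sup>+ z. B w (fst z) \<partial>P) \<partial>prod_law ?J)"
    by (intro nn_integral_mono second_moment B_meas)
  also have "\<dots> = ennreal M * (\<integral>\<^sup>+ w. ennreal (of_bool (nn_index x w L = i)) \<partial>prod_law I)"
    using product_nn_integral_insert[OF J meas(2)]
    unfolding I by (subst nn_integral_cmult[OF meas']) (simp add: B del: fun_upd_apply)
  finally show ?thesis .
qed

text \<open>The selection probabilities over \<open>L\<close> add up to 1, so the bound
  \<open>M\<close> does not deteriorate with the size of the subsample.\<close>

lemma nn_integral_nn_value_square_le: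
  assumes "finite I" "L \<subseteq> I" "L \<noteq> {}"
  shows "(\<integral>\<^sup>+ w. ennreal ((nn_value x w L)\<^sup>2) \<partial>prod_law I) \<le> ennreal M"
proof -
  interpret Q: prob_space "prod_law I" by (rule prob_space_prod_law)
  have fin: "finite L" using assms finite_subset by blast
  note measurable_nn_index[OF assms(2), measurable]
  have meas: "(\<lambda>w. ennreal (of_bool (nn_index x w L = i) * (snd (w i))\<^sup>2)) \<in> borel_measurable (prod_law I)"
    if "i \<in> L" for i
  proof -
    have [measurable]: "i \<in> I" using assms that by auto
    show ?thesis by measurable
  qed
  have one: "(\<Sum>i\<in>L. ennreal (of_bool (nn_index x w L = i))) = 1" for w
  proof -
    have "(\<Sum>i\<in>L. ennreal (of_bool (nn_index x w L = i))) = (\<Sum>i\<in>L. if i = nn_index x w L then 1 else 0)"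
      by (intro sum.cong) auto
    then show ?thesis using nn_index_nearest[OF fin assms(3), of x w] fin by simp
  qed
  have "(\<integral>\<^sup>+ w. ennreal ((nn_value x w L)\<^sup>2) \<partial>prod_law I) =
      (\<integral>\<^sup>+ w. (\<Sum>i\<in>L. ennreal (of_bool (nn_index x w L = i) * (snd (w i))\<^sup>2)) \<partial>prod_law I)"
    unfolding nn_value_square_eq_sum[OF fin assms(3)] by (subst sum_ennreal) simp_all
  also have "\<dots> = (\<Sum>i\<in>L. \<integral>\<^sup>+ w. ennreal (of_bool (nn_index x w L = i) * (snd (w i))\<^sup>2) \<partial>prod_law I)"
    by (rule nn_integral_sum) (rule meas)
  also have "\<dots> \<le> (\<Sum>i\<in>L. ennreal M * (\<integral>\<^sup>+ w. ennreal (of_bool (nn_index x w L = i)) \<partial>prod_law I))"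
    using assms by (intro sum_mono nn_integral_nearest_response_le)
  also have "\<dots> = ennreal M * (\<integral>\<^sup>+ w. (\<Sum>i\<in>L. ennreal (of_bool (nn_index x w L = i))) \<partial>prod_law I)"
    unfolding sum_distrib_left[symmetric] by (subst nn_integral_sum) auto
  finally show ?thesis by (simp add: one Q.emeasure_space_1)
qed

lemma integral_nn_value_square_le:
  assumes "finite I" "L \<subseteq> I" "L \<noteq> {}"
  shows "integrable (prod_law I) (\<lambda>w. (nn_value x w L)\<^sup>2)"
    and "(\<integral>w. (nn_value x w L)\<^sup>2 \<partial>prod_law I) \<le> M"
proof -
  have [measurable]: "(\<lambda>w. nn_value x w L) \<in> borel_measurable (prod_law I)"
    using assms by (intro measurable_nn_value) (auto intro: finite_subset)
  note le = nn_integral_nn_value_square_le[OF assms]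
  show "integrable (prod_law I) (\<lambda>w. (nn_value x w L)\<^sup>2)"
    using le by (intro integrableI_bounded) (auto intro: le_less_trans)
  show "(\<integral>w. (nn_value x w L)\<^sup>2 \<partial>prod_law I) \<le> M"
    using le M_nonneg by (subst integral_eq_nn_integral) (auto intro: enn2real_leI)
qed

lemma zetam_lin_kernel_le: "zetam P m (lin_kernel W m x) \<le> (total_weight W m)\<^sup>2 * M"
proof -
  let ?Q = "prod_law {0..<m}" and ?g = "lin_kernel W m x"
  interpret Q: prob_space ?Q by (rule prob_space_prod_law)
  have int: "integrable ?Q (\<lambda>w. (nn_value x w L)\<^sup>2)"
    and le: "(\<integral>w. (nn_value x w L)\<^sup>2 \<partial>?Q) \<le> M" if "L \<in> Pow {0..<m} - {{}}" for L
    using integral_nn_value_square_le[of "{0..<m}" L] that by auto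
  have "zetam P m ?g = Q.variance ?g"
    by (simp add: zetam_def Let_def)
  also have "\<dots> \<le> (\<integral>w. (?g w)\<^sup>2 \<partial>?Q)"
    by (subst Q.variance_eq[OF lin_kernel_integrable lin_kernel_square_integrable]) simp
  also have "\<dots> \<le> (\<integral>w. total_weight W m *
      (\<Sum>L\<in>Pow {0..<m} - {{}}. \<bar>W L\<bar> * (nn_value x w L)\<^sup>2) \<partial>?Q)"
    by (intro integral_mono lin_kernel_square_integrable integrable_mult_right
        Bochner_Integration.integrable_sum int lin_kernel_square_le) auto
  also have "\<dots> = total_weight W m *
      (\<Sum>L\<in>Pow {0..<m} - {{}}. \<bar>W L\<bar> * (\<integral>w. (nn_value x w L)\<^sup>2 \<partial>?Q))"
    using int by (simp add: Bochner_Integration.integral_sum)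
  also have "\<dots> \<le> total_weight W m * (\<Sum>L\<in>Pow {0..<m} - {{}}. \<bar>W L\<bar> * M)"
    by (intro mult_left_mono sum_mono le) (auto intro: sum_nonneg)
  finally show ?thesis
    by (simp add: sum_distrib_right power2_eq_square mult.assoc)
qed

subsection \<open>Moments of the uniform variable\<close>

text \<open>The survival function of the distance to \<open>x\<close>, evaluated at the distance of
  \<open>u\<close>. The comparison is non-strict because ties are resolved in favour of index
  0.\<close>

definition far :: "'a \<Rightarrow> real" where
  "far u = (\<integral>z. of_bool (dist u x \<le> dist (fst z) x) \<partial>P)"

lemma far_measurable [measurable]: "far \<in> borel_measurable borel"
  unfolding far_def[abs_def] by (rule borel_measurable_lebesgue_integral) measurable

lemma far_nonneg: "0 \<le> far u"
  unfolding far_def by (rule Bochner_Integration.integral_nonneg) simp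

lemma far_le_1: "far u \<le> 1"
proof -
  have "far u \<le> (\<integral>z. 1 \<partial>P)"
    unfolding far_def
    by (intro integral_mono integrable_const_bound[where B = 1]) auto
  then show ?thesis by (simp add: prob_space[simplified])
qed

lemma far_power_integrable: "integrable P (\<lambda>z. far (fst z) ^ j)"
  by (rule integrable_const_bound[where B = 1])
    (auto simp: far_nonneg power_le_one far_le_1)

text \<open>By independence the event has a product probability, with one factor
  \<open>far u\<close> for each index in \<open>A\<close>.\<close>

lemma integral_all_far:
  assumes "finite J" "A \<subseteq> J"
  shows "(\<integral>w. of_bool (\<forall>j\<in>A. dist u x \<le> dist (fst (w j)) x) \<partial>prod_law J) = far u ^ card A"
    and "integrable (prod_law J) (\<lambda>w. of_bool (\<forall>j\<in>A. dist u x \<le> dist (fst (w j)) x) :: real)"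
proof -
  have fin: "finite A" using assms finite_subset by blast
  \<comment> \<open>Padding with the factor 1 outside \<open>A\<close> lets the product run over all
    coordinates of the law.\<close>
  define F where "F j z = (if j \<in> A then of_bool (dist u x \<le> dist (fst z) x) else 1 :: real)"
    for j and z :: "'a \<times> real"
  have F: "of_bool (\<forall>j\<in>A. dist u x \<le> dist (fst (w j)) x) = (\<Prod>j\<in>J. F j (w j))" for w :: "nat \<Rightarrow> 'a \<times> real"
  proof (cases "\<forall>j\<in>A. dist u x \<le> dist (fst (w j)) x")
    case True
    then have "(\<Prod>j\<in>J. F j (w j)) = 1"
      by (intro prod.neutral) (simp add: F_def)
    then show ?thesis using True by simp
  next
    case False
    then have "(\<Prod>j\<in>J. F j (w j)) = 0"
      using assms by (intro prod_zero) (auto simp: F_def)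
    then show ?thesis using False by simp
  qed
  have int: "integrable P (F j)" for j
    by (rule integrable_const_bound[where B = 1]) (auto simp: F_def[abs_def])
  have "(\<integral>w. (\<Prod>j\<in>J. F j (w j)) \<partial>prod_law J) = (\<Prod>j\<in>J. integral\<^sup>L P (F j))"
    by (rule product_integral_prod[OF assms(1) int])
  also have "\<dots> = (\<Prod>j\<in>J. if j \<in> A then far u else 1)"
    by (intro prod.cong) (auto simp: F_def[abs_def] far_def prob_space[simplified])
  also have "\<dots> = far u ^ card A"
    using assms by (simp add: prod.If_cases Int_absorb1)
  finally show "(\<integral>w. of_bool (\<forall>j\<in>A. dist u x \<le> dist (fst (w j)) x) \<partial>prod_law J) = far u ^ card A"
    unfolding F .
  show "integrable (prod_law J) (\<lambda>w. of_bool (\<forall>j\<in>A. dist u x \<le> dist (fst (w j)) x) :: real)"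
    unfolding F by (rule product_integrable_prod[OF assms(1) int])
qed

text \<open>Once observation \<open>k\<close> is fixed, a tie forces covariate \<open>i\<close> onto
  a sphere around \<open>x\<close>, a null event by \<open>no_ties\<close>.\<close>

lemma AE_no_tie:
  assumes "finite I" "i \<in> I" "k \<in> I" "i \<noteq> k"
  shows "AE w in prod_law I. dist (fst (w i)) x \<noteq> dist (fst (w k)) x"
proof -
  let ?J = "I - {i}"
  have I: "insert i ?J = I" and J: "finite ?J" "i \<notin> ?J" and [measurable]: "i \<in> I" "k \<in> I"
    using assms by auto
  let ?F = "\<lambda>w :: nat \<Rightarrow> 'a \<times> real. indicator {w. dist (fst (w i)) x = dist (fst (w k)) x} w :: ennreal"
  have [measurable]: "Measurable.pred (prod_law I) (\<lambda>w. dist (fst (w i)) x = dist (fst (w k)) x)"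
    unfolding order_eq_iff[of "dist (fst (w i)) x" for w] by measurable
  then have meas: "?F \<in> borel_measurable (prod_law (insert i ?J))"
    unfolding I by measurable
  have "(\<integral>\<^sup>+ w. ?F w \<partial>prod_law I) =
      (\<integral>\<^sup>+ w. (\<integral>\<^sup>+ z. indicator {z. dist (fst z) x = dist (fst (w k)) x} z \<partial>P) \<partial>prod_law ?J)"
    using product_nn_integral_insert[OF J meas] \<open>i \<noteq> k\<close> unfolding I by (simp add: indicator_def)
  also have "\<dots> = (\<integral>\<^sup>+ w. 0 \<partial>prod_law ?J)"
  proof (rule nn_integral_cong)
    fix w :: "nat \<Rightarrow> 'a \<times> real"
    have "Measurable.pred P (\<lambda>z. dist (fst z) x = dist (fst (w k)) x)"
      unfolding order_eq_iff[of "dist (fst z) x" for z] by measurable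
    then have "{z. dist (fst z) x = dist (fst (w k)) x} \<in> sets P"
      by (simp add: pred_def)
    then show "(\<integral>\<^sup>+ z. indicator {z. dist (fst z) x = dist (fst (w k)) x} z \<partial>P) = 0"
      by (simp add: no_ties)
  qed
  finally have "(\<integral>\<^sup>+ w. ?F w \<partial>prod_law I) = 0" by simp
  then have "AE w in prod_law I. ?F w = 0"
    using meas unfolding I by (subst (asm) nn_integral_0_iff_AE) auto
  then show ?thesis by (auto elim!: eventually_mono)
qed

text \<open>By symmetry: among \<open>j + 1\<close> covariates each one is the closest with probability
  \<open>\<integral> far\<^sup>j\<close>, and almost surely exactly one of them is.\<close>
lemma far_moment: "(\<integral>z. far (fst z) ^ j \<partial>P) = 1 / real (Suc j)"
proof -
  let ?I = "{0..<Suc j}"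
  interpret Q: prob_space "prod_law ?I" by (rule prob_space_prod_law)
  define N where "N i w \<longleftrightarrow> (\<forall>k\<in>?I. dist (fst (w i)) x \<le> dist (fst (w k)) x)"
    for i and w :: "nat \<Rightarrow> 'a \<times> real"
  have N_int: "integrable (prod_law ?I) (\<lambda>w. of_bool (N i w) :: real)" if [measurable]: "i \<in> ?I" for i
  proof (rule Q.integrable_const_bound[where B = 1])
    have "Measurable.pred (prod_law ?I) (\<lambda>w. dist (fst (w i)) x \<le> dist (fst (w k)) x)" if [measurable]: "k \<in> ?I" for k
      by measurable
    then have [measurable]: "Measurable.pred (prod_law ?I) (N i)"
      unfolding N_def[abs_def] by (intro pred_intros_countable_bounded) auto
    show "(\<lambda>w. of_bool (N i w) :: real) \<in> borel_measurable (prod_law ?I)"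
      by measurable
  qed simp
  have N: "(\<integral>w. of_bool (N i w) \<partial>prod_law ?I) = (\<integral>z. far (fst z) ^ j \<partial>P)" if "i \<in> ?I" for i
  proof -
    let ?J = "?I - {i}"
    have I: "insert i ?J = ?I" and J: "finite ?J" "i \<notin> ?J"
      using that by auto
    have "(\<integral>w. of_bool (N i w) \<partial>prod_law ?I) =
        ((\<integral>z. (\<integral>w. of_bool (N i (w(i := z))) \<partial>prod_law ?J) \<partial>P) :: real)"
      by (rule product_integral_insert_rev[OF J, unfolded I, OF N_int[OF that]])
    also have "\<dots> = (\<integral>z. (\<integral>w. of_bool (\<forall>k\<in>?J. dist (fst z) x \<le> dist (fst (w k)) x) \<partial>prod_law ?J) \<partial>P)"
      by (intro Bochner_Integration.integral_cong refl arg_cong[where f = of_bool])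
        (auto simp: N_def)
    also have "\<dots> = (\<integral>z. far (fst z) ^ j \<partial>P)"
      using that by (subst integral_all_far(1)) auto
    finally show ?thesis .
  qed
  have "AE w in prod_law ?I. \<forall>i\<in>?I. \<forall>k\<in>?I. i \<noteq> k \<longrightarrow> dist (fst (w i)) x \<noteq> dist (fst (w k)) x"
  proof (intro AE_finite_allI)
    fix i k assume "i \<in> ?I" "k \<in> ?I"
    then show "AE w in prod_law ?I. i \<noteq> k \<longrightarrow> dist (fst (w i)) x \<noteq> dist (fst (w k)) x"
      using AE_no_tie[of ?I i k] by (cases "i = k") auto
  qed auto
  then have one: "AE w in prod_law ?I. (\<Sum>i\<in>?I. of_bool (N i w)) = (1 :: real)"
  proof (rule eventually_mono)
    fix w :: "nat \<Rightarrow> 'a \<times> real"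
    assume w: "\<forall>i\<in>?I. \<forall>k\<in>?I. i \<noteq> k \<longrightarrow> dist (fst (w i)) x \<noteq> dist (fst (w k)) x"
    let ?i = "nn_index x w ?I"
    have i: "?i \<in> ?I" "N ?i w"
      using nn_index_nearest[of ?I x w] by (auto simp: N_def simp del: atLeast0_lessThan_Suc)
    \<comment> \<open>Two nearest observations are at equal distance from \<open>x\<close>, which
      \<open>w\<close> rules out for distinct indices.\<close>
    have "N k w \<longleftrightarrow> k = ?i" if "k \<in> ?I" for k
      using i w that unfolding N_def by (metis order_antisym)
    then have "(\<Sum>i\<in>?I. of_bool (N i w)) = (\<Sum>k\<in>?I. if k = ?i then 1 else 0 :: real)"
      by (intro sum.cong) auto
    also have "\<dots> = 1" using i by (subst sum.delta) auto
    finally show "(\<Sum>i\<in>?I. of_bool (N i w)) = (1 :: real)" .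
  qed
  have "real (Suc j) * (\<integral>z. far (fst z) ^ j \<partial>P) = (\<Sum>i\<in>?I. \<integral>w. of_bool (N i w) \<partial>prod_law ?I)"
    by (subst sum.cong[OF refl N]) auto
  also have "\<dots> = (\<integral>w. (\<Sum>i\<in>?I. of_bool (N i w)) \<partial>prod_law ?I)"
    by (rule Bochner_Integration.integral_sum[symmetric]) (rule N_int)
  also have "\<dots> = (\<integral>w. 1 \<partial>prod_law ?I)"
    using one N_int by (intro integral_cong_AE borel_measurable_sum borel_measurable_integrable) auto
  also have "\<dots> = 1" by (simp add: Q.prob_space)
  finally show ?thesis by (simp add: field_simps)
qed

subsection \<open>The projection on the first observation\<close>

text \<open>Given covariate \<open>u\<close>, observation 0 is selected from \<open>L\<close> when
  the other \<open>card L - 1\<close> covariates are at least as far away; this has probability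
  \<open>far u ^ (card L - 1)\<close>.\<close>

definition proj_slope :: "(nat set \<Rightarrow> real) \<Rightarrow> nat \<Rightarrow> 'a \<Rightarrow> real" where
  "proj_slope W m u = (\<Sum>L\<in>Pow {0..<m} - {{}}. if 0 \<in> L then W L * far u ^ (card L - 1) else 0)"

text \<open>The conditional expectation of the kernel given that the first observation equals
  \<open>z\<close>, without centring.\<close>

definition hajek_proj :: "(nat set \<Rightarrow> real) \<Rightarrow> nat \<Rightarrow> 'a \<times> real \<Rightarrow> real" where
  "hajek_proj W m z = (\<integral>w. lin_kernel W m x (w(0 := z)) \<partial>prod_law {Suc 0..<m})"

lemma proj_slope_measurable [measurable]: "proj_slope W m \<in> borel_measurable borel"
  unfolding proj_slope_def[abs_def] by measurable

lemma abs_proj_slope_le: "\<bar>proj_slope W m u\<bar> \<le> total_weight W m"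
  unfolding proj_slope_def
proof (rule order_trans[OF sum_abs], rule sum_mono)
  fix L
  have "\<bar>W L\<bar> * far u ^ (card L - 1) \<le> \<bar>W L\<bar> * 1"
    by (intro mult_left_mono power_le_one far_nonneg far_le_1) simp
  then show "\<bar>if 0 \<in> L then W L * far u ^ (card L - 1) else 0\<bar> \<le> \<bar>W L\<bar>"
    by (simp add: abs_mult far_nonneg)
qed

lemma proj_slope_square_le: "(proj_slope W m u)\<^sup>2 \<le> (total_weight W m)\<^sup>2"
  using power_mono[OF abs_proj_slope_le abs_ge_zero, where n = 2] by simp

lemma proj_slope_square_integrable: "integrable P (\<lambda>z. (proj_slope W m (fst z))\<^sup>2)"
  by (rule integrable_const_bound[where B = "(total_weight W m)\<^sup>2"])
    (simp_all add: proj_slope_square_le)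

context
  fixes W :: "nat set \<Rightarrow> real" and m :: nat
  assumes m_pos: "0 < m"
begin

lemma insert_0_indices: "insert 0 {Suc 0..<m} = {0..<m}"
  using m_pos by auto

lemma measurable_update_0 [measurable]:
  "(\<lambda>w. w(0 := z)) \<in> measurable (prod_law {Suc 0..<m}) (prod_law {0..<m})"
  by (rule measurable_fun_upd[where J = "{Suc 0..<m}"]) (use insert_0_indices in auto)

lemma measurable_kernel_update_0 [measurable]:
  "(\<lambda>w. lin_kernel W m x (w(0 := z))) \<in> borel_measurable (prod_law {Suc 0..<m})"
  by (rule measurable_compose[OF measurable_update_0 measurable_lin_kernel])

lemma abs_kernel_update_0_le:
  "\<bar>lin_kernel W m x (w(0 := z))\<bar> \<le> total_weight W m * (\<bar>snd z\<bar> + (\<Sum>i\<in>{Suc 0..<m}. \<bar>snd (w i)\<bar>))"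
proof -
  have "(\<Sum>i\<in>{0..<m}. \<bar>snd ((w(0 := z)) i)\<bar>) = \<bar>snd z\<bar> + (\<Sum>i\<in>{Suc 0..<m}. \<bar>snd (w i)\<bar>)"
    by (subst insert_0_indices[symmetric]) (simp add: sum.insert)
  then show ?thesis
    using abs_lin_kernel_le[of W m x "w(0 := z)"] by simp
qed

lemma kernel_update_0_integrable:
  "integrable (prod_law {Suc 0..<m}) (\<lambda>w. lin_kernel W m x (w(0 := z)))"
  by (rule integrable_of_square_integrable[OF measurable_kernel_update_0
        dominated_square_integrable[OF measurable_kernel_update_0 _ abs_kernel_update_0_le]]) simp

lemma hajek_proj_measurable [measurable]: "hajek_proj W m \<in> borel_measurable P"
proof -
  interpret I: finite_product_sigma_finite "\<lambda>_. P" "{Suc 0..<m}" by standard simp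
  have "(\<lambda>p. (snd p)(0 := fst p)) \<in> measurable (P \<Otimes>\<^sub>M prod_law {Suc 0..<m}) (prod_law {0..<m})"
    by (rule measurable_fun_upd[where J = "{Suc 0..<m}"]) (use insert_0_indices in auto)
  from measurable_compose[OF this measurable_lin_kernel]
  have "(\<lambda>(z, w). lin_kernel W m x (w(0 := z))) \<in> borel_measurable (P \<Otimes>\<^sub>M prod_law {Suc 0..<m})"
    by (simp add: split_beta')
  then show ?thesis
    unfolding hajek_proj_def[abs_def] by (rule I.borel_measurable_lebesgue_integral)
qed

text \<open>By \<open>nn_value_upd_0\<close> every subsample is affine in the response of
  observation 0. Averaging over the other observations turns the selection indicators into powers of
  \<open>far u\<close>.\<close>

lemma hajek_proj_affine:
  "hajek_proj W m (u, y) = hajek_proj W m (u, 0) + proj_slope W m u * y"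
proof -
  \<comment> \<open>Index 0 is removed since its comparison with itself is trivial and coordinate 0
    is not integrated.\<close>
  let ?near = "\<lambda>L w. \<forall>j\<in>L - {0}. dist u x \<le> dist (fst (w j :: 'a \<times> real)) x"
  \<comment> \<open>The slope in \<open>y\<close> before averaging over the other
    observations.\<close>
  define C where "C w = (\<Sum>L\<in>Pow {0..<m} - {{}}. if 0 \<in> L then W L * of_bool (?near L w) else 0)" for w
  have far: "(\<integral>w. of_bool (?near L w) \<partial>prod_law {Suc 0..<m}) = far u ^ (card L - 1)"
    "integrable (prod_law {Suc 0..<m}) (\<lambda>w. of_bool (?near L w) :: real)"
    if "L \<in> Pow {0..<m} - {{}}" "0 \<in> L" for L
  proof -
    have "L - {0} \<subseteq> {Suc 0..<m}" "card (L - {0}) = card L - 1"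
      using that by (auto simp: subset_iff Suc_le_eq)
    then show "(\<integral>w. of_bool (?near L w) \<partial>prod_law {Suc 0..<m}) = far u ^ (card L - 1)"
      "integrable (prod_law {Suc 0..<m}) (\<lambda>w. of_bool (?near L w) :: real)"
      using integral_all_far[of "{Suc 0..<m}" "L - {0}" u] by auto
  qed
  have kernel: "lin_kernel W m x (w(0 := (u, y))) = lin_kernel W m x (w(0 := (u, 0))) + C w * y" for w
  proof -
    have "W L * nn_value x (w(0 := (u, y))) L = W L * nn_value x (w(0 := (u, 0))) L +
        (if 0 \<in> L then W L * of_bool (?near L w) else 0) * y"
      if L: "L \<in> Pow {0..<m} - {{}}" for L
    proof -
      have "finite L" "L \<noteq> {}" using L finite_subset by auto
      moreover from this have "nn_index x (w(0 := (u, 0))) L = 0 \<longleftrightarrow> 0 \<in> L \<and> ?near L w"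
        by (subst nn_index_eq_0_iff) auto
      ultimately show ?thesis
        by (subst nn_value_upd_0) (auto simp: algebra_simps)
    qed
    then show ?thesis
      unfolding lin_kernel_def C_def by (simp add: sum.distrib[symmetric] sum_distrib_right)
  qed
  have term_int: "integrable (prod_law {Suc 0..<m}) (\<lambda>w. if 0 \<in> L then W L * of_bool (?near L w) else 0)"
    if "L \<in> Pow {0..<m} - {{}}" for L
    using far(2)[OF that] by (cases "0 \<in> L") simp_all
  have C_int: "integrable (prod_law {Suc 0..<m}) C"
    unfolding C_def[abs_def]
    by (intro Bochner_Integration.integrable_sum term_int)
  have "(\<integral>w. C w \<partial>prod_law {Suc 0..<m}) = (\<Sum>L\<in>Pow {0..<m} - {{}}.
      \<integral>w. (if 0 \<in> L then W L * of_bool (?near L w) else 0) \<partial>prod_law {Suc 0..<m})"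
    unfolding C_def by (intro Bochner_Integration.integral_sum term_int)
  also have "\<dots> = proj_slope W m u"
    unfolding proj_slope_def by (intro sum.cong) (simp_all add: far)
  finally have C: "(\<integral>w. C w \<partial>prod_law {Suc 0..<m}) = proj_slope W m u" .
  show ?thesis
    unfolding hajek_proj_def kernel
    using C C_int kernel_update_0_integrable[of "(u, 0)"] by simp
qed

text \<open>Averaging the linear growth bound of the kernel leaves linear growth in the single
  response, with the constant \<open>b\<close> absorbing the mean of the others.\<close>

lemma hajek_proj_square_integrable: "integrable P (\<lambda>z. (hajek_proj W m z)\<^sup>2)"
proof (rule Bochner_Integration.integrable_bound)
  interpret R: prob_space "prod_law {Suc 0..<m}" by (rule prob_space_prod_law)
  let ?T = "total_weight W m"
  let ?s = "\<lambda>w. \<Sum>i\<in>{Suc 0..<m}. \<bar>snd (w i :: 'a \<times> real)\<bar>"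
  have [measurable]: "(\<lambda>z. \<bar>snd z\<bar>) \<in> borel_measurable P" by measurable
  have s_int: "integrable (prod_law {Suc 0..<m}) ?s"
  proof (intro Bochner_Integration.integrable_sum integrable_abs)
    fix i assume [measurable]: "i \<in> {Suc 0..<m}"
    show "integrable (prod_law {Suc 0..<m}) (\<lambda>w. snd (w i))"
      by (rule integrable_of_square_integrable[OF _ component_square_integrable]) measurable
  qed
  define b where "b = (\<integral>w. ?s w \<partial>prod_law {Suc 0..<m})"
  show "integrable P (\<lambda>z. ?T\<^sup>2 * (\<bar>snd z\<bar> + b)\<^sup>2)"
    by (rule integrable_mult_right, rule integrable_add_square)
      (simp_all add: response_square_integrable)
  show "AE z in P. norm ((hajek_proj W m z)\<^sup>2) \<le> norm (?T\<^sup>2 * (\<bar>snd z\<bar> + b)\<^sup>2)"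
  proof (rule AE_I2)
    fix z
    have "\<bar>hajek_proj W m z\<bar> \<le> (\<integral>w. \<bar>lin_kernel W m x (w(0 := z))\<bar> \<partial>prod_law {Suc 0..<m})"
      unfolding hajek_proj_def by (rule integral_abs_bound)
    also have "\<dots> \<le> (\<integral>w. ?T * (\<bar>snd z\<bar> + ?s w) \<partial>prod_law {Suc 0..<m})"
      using s_int by (intro integral_mono[OF integrable_abs[OF kernel_update_0_integrable] _ abs_kernel_update_0_le]) simp
    also have "\<dots> = ?T * (\<bar>snd z\<bar> + b)"
      using s_int by (simp add: b_def R.prob_space)
    finally have "\<bar>hajek_proj W m z\<bar>\<^sup>2 \<le> (?T * (\<bar>snd z\<bar> + b))\<^sup>2"
      by (intro power_mono) auto
    then show "norm ((hajek_proj W m z)\<^sup>2) \<le> norm (?T\<^sup>2 * (\<bar>snd z\<bar> + b)\<^sup>2)"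
      by (simp add: power_mult_distrib)
  qed
qed measurable

lemma noise_square_integrable: "integrable P (\<lambda>z. (snd z - \<mu> (fst z))\<^sup>2)"
  using integrable_add_square[of snd P "\<lambda>z. - \<mu> (fst z)"] response_square_integrable \<mu>_square
  by simp

text \<open>The noise part \<open>proj_slope u * (y - \<mu> u)\<close> of the projection is orthogonal to every
  function of the covariate.\<close>
lemma hajek_proj_variance_ge:
  "v * (\<integral>z. (proj_slope W m (fst z))\<^sup>2 \<partial>P) \<le> (\<integral>z. (hajek_proj W m z - E)\<^sup>2 \<partial>P)"
proof -
  let ?c = "proj_slope W m"
  \<comment> \<open>Substituting \<open>y = \<mu> u + (y - \<mu> u)\<close> in the affine form
    splits the centred projection into \<open>e\<close>, a function of the covariate, and the noise
    part \<open>N\<close>.\<close>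
  define e where "e u = hajek_proj W m (u, 0) + ?c u * \<mu> u - E" for u
  define N where "N z = ?c (fst z) * (snd z - \<mu> (fst z))" for z
  have "(\<lambda>u. (u, 0::real)) \<in> measurable borel P" by measurable
  from measurable_compose[OF this hajek_proj_measurable]
  have [measurable]: "e \<in> borel_measurable borel"
    unfolding e_def[abs_def] by measurable
  have [measurable]: "N \<in> borel_measurable P"
    unfolding N_def[abs_def] by measurable
  have split: "hajek_proj W m z - E = N z + e (fst z)" for z
    using hajek_proj_affine[of "fst z" "snd z"] by (simp add: e_def N_def algebra_simps)
  have N_int: "integrable P (\<lambda>z. (N z)\<^sup>2)"
  proof (rule Bochner_Integration.integrable_bound)
    show "integrable P (\<lambda>z. (total_weight W m)\<^sup>2 * (snd z - \<mu> (fst z))\<^sup>2)"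
      by (intro integrable_mult_right noise_square_integrable)
    show "AE z in P. norm ((N z)\<^sup>2) \<le> norm ((total_weight W m)\<^sup>2 * (snd z - \<mu> (fst z))\<^sup>2)"
      by (intro AE_I2) (simp add: N_def power_mult_distrib mult_right_mono proj_slope_square_le)
  qed measurable
  have proj_int: "integrable P (\<lambda>z. (hajek_proj W m z - E)\<^sup>2)"
    using integrable_add_square[of "hajek_proj W m" P "\<lambda>_. - E"] hajek_proj_square_integrable
    by simp
  \<comment> \<open>Square integrability of \<open>e\<close> is obtained by subtracting
    \<open>N\<close> from the centred projection.\<close>
  have "integrable P (\<lambda>z. ((hajek_proj W m z - E) + - N z)\<^sup>2)"
    by (rule integrable_add_square) (simp_all add: proj_int N_int)
  then have e_int: "integrable P (\<lambda>z. (e (fst z))\<^sup>2)"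
    by (simp add: split)
  have cross_int: "integrable P (\<lambda>z. N z * e (fst z))"
    by (rule integrable_mult_of_squares) (simp_all add: N_int e_int)
  have cross: "(\<integral>z. N z * e (fst z) \<partial>P) = 0"
    using noise_centered[of "\<lambda>u. ?c u * e u"] by (simp add: N_def mult_ac)
  have c_int: "integrable P (\<lambda>z. (?c (fst z))\<^sup>2)"
    by (rule proj_slope_square_integrable)
  have "ennreal (v * (\<integral>z. (?c (fst z))\<^sup>2 \<partial>P)) = ennreal v * (\<integral>\<^sup>+ z. ennreal ((?c (fst z))\<^sup>2) \<partial>P)"
    using c_int v_pos by (simp add: nn_integral_eq_integral ennreal_mult)
  also have "\<dots> \<le> (\<integral>\<^sup>+ z. ennreal ((snd z - \<mu> (fst z))\<^sup>2) * ennreal ((?c (fst z))\<^sup>2) \<partial>P)"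
    by (rule noise_variance) measurable
  also have "\<dots> = (\<integral>\<^sup>+ z. ennreal ((N z)\<^sup>2) \<partial>P)"
    by (intro nn_integral_cong) (simp add: N_def power_mult_distrib ennreal_mult mult.commute)
  also have "\<dots> = ennreal (\<integral>z. (N z)\<^sup>2 \<partial>P)"
    using N_int by (simp add: nn_integral_eq_integral)
  finally have "v * (\<integral>z. (?c (fst z))\<^sup>2 \<partial>P) \<le> (\<integral>z. (N z)\<^sup>2 \<partial>P)"
    by (simp add: ennreal_le_iff)
  also have "\<dots> \<le> (\<integral>z. (N z)\<^sup>2 \<partial>P) + (\<integral>z. (e (fst z))\<^sup>2 \<partial>P)"
    by simp
  also have "\<dots> = (\<integral>z. (hajek_proj W m z - E)\<^sup>2 \<partial>P)"
    using N_int e_int cross cross_int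
    by (simp add: split power2_sum mult.assoc)
  finally show ?thesis .
qed

end

text \<open>Expanding \<open>\<integral> (proj_slope - far\<^sup>m)\<^sup>2 \<ge> 0\<close> replaces the quadratic form in the weights by a
  linear one.\<close>
lemma proj_slope_square_ge:
  "2 * (\<Sum>L\<in>Pow {0..<m} - {{}}. if 0 \<in> L then W L / real (card L + m) else 0) - 1 / real (2 * m + 1)
    \<le> (\<integral>z. (proj_slope W m (fst z))\<^sup>2 \<partial>P)"
proof -
  let ?c = "\<lambda>z :: 'a \<times> real. proj_slope W m (fst z)"
  let ?f = "\<lambda>z :: 'a \<times> real. far (fst z) ^ m"
  let ?S = "Pow {0..<m} - {{}}"
  have c_int: "integrable P (\<lambda>z. (?c z)\<^sup>2)"
    by (rule proj_slope_square_integrable)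
  have ff: "?f z * ?f z = far (fst z) ^ (2 * m)" for z
    by (simp add: mult_2 power_add)
  have cf: "?c z * ?f z = (\<Sum>L\<in>?S. if 0 \<in> L then W L * far (fst z) ^ (card L - 1 + m) else 0)" for z
    unfolding proj_slope_def sum_distrib_right by (intro sum.cong) (auto simp: power_add)
  have cf_term: "integrable P (\<lambda>z. if 0 \<in> L then W L * far (fst z) ^ (card L - 1 + m) else 0)" for L
    by (cases "0 \<in> L") (simp_all add: far_power_integrable)
  have cf_int: "integrable P (\<lambda>z. ?c z * ?f z)"
    unfolding cf by (intro Bochner_Integration.integrable_sum cf_term)
  have ff_int: "integrable P (\<lambda>z. ?f z * ?f z)"
    unfolding ff by (rule far_power_integrable)
  have "(\<integral>z. ?c z * ?f z \<partial>P) =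
      (\<Sum>L\<in>?S. \<integral>z. (if 0 \<in> L then W L * far (fst z) ^ (card L - 1 + m) else 0) \<partial>P)"
    unfolding cf by (intro Bochner_Integration.integral_sum cf_term)
  also have "\<dots> = (\<Sum>L\<in>?S. if 0 \<in> L then W L / real (card L + m) else 0)"
  proof (intro sum.cong refl)
    fix L assume "L \<in> ?S"
    then have "card L > 0" by (auto simp: card_gt_0_iff intro: finite_subset)
    \<comment> \<open>As \<open>L\<close> is nonempty, the truncated subtraction is exact, and the
      moment of exponent \<open>card L - 1 + m\<close> is \<open>1 / (card L + m)\<close>.\<close>
    then have "Suc (card L - 1 + m) = card L + m" by simp
    then show "(\<integral>z. (if 0 \<in> L then W L * far (fst z) ^ (card L - 1 + m) else 0) \<partial>P) =
        (if 0 \<in> L then W L / real (card L + m) else 0)"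
      using far_moment[of "card L - 1 + m"] by simp
  qed
  finally have cf_eq: "(\<integral>z. ?c z * ?f z \<partial>P) = (\<Sum>L\<in>?S. if 0 \<in> L then W L / real (card L + m) else 0)" .
  have ff_eq: "(\<integral>z. ?f z * ?f z \<partial>P) = 1 / real (2 * m + 1)"
    unfolding ff using far_moment[of "2 * m"] by simp
  have "2 * (\<integral>z. ?c z * ?f z \<partial>P) - (\<integral>z. ?f z * ?f z \<partial>P) = (\<integral>z. 2 * (?c z * ?f z) - ?f z * ?f z \<partial>P)"
    using cf_int ff_int by simp
  also have "\<dots> \<le> (\<integral>z. (?c z)\<^sup>2 \<partial>P)"
  proof (intro integral_mono c_int Bochner_Integration.integrable_diff integrable_mult_right cf_int ff_int)
    fix z :: "'a \<times> real"
    show "2 * (?c z * ?f z) - ?f z * ?f z \<le> (?c z)\<^sup>2"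
      using zero_le_power2[of "?c z - ?f z"] by (simp add: power2_diff power2_eq_square[of "?f z"])
  qed
  finally show ?thesis unfolding cf_eq ff_eq .
qed

section \<open>The covariance of two kernels sharing one observation\<close>

lemma prod_law_reindex:
  fixes F :: "_ \<Rightarrow> real"
  assumes "inj_on r I" "r \<in> I \<rightarrow> K" and [measurable]: "F \<in> borel_measurable (prod_law I)"
  shows "(\<integral>w. F (\<lambda>i\<in>I. w (r i)) \<partial>prod_law K) = integral\<^sup>L (prod_law I) F"
    and "integrable (prod_law K) (\<lambda>w. F (\<lambda>i\<in>I. w (r i))) \<longleftrightarrow> integrable (prod_law I) F"
proof -
  have T: "(\<lambda>w. \<lambda>i\<in>I. w (r i)) \<in> measurable (prod_law K) (prod_law I)"
    using assms(2) by (intro measurable_restrict measurable_component_singleton) auto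
  have D: "distr (prod_law K) (prod_law I) (\<lambda>w. \<lambda>i\<in>I. w (r i)) = prod_law I"
    using assms by (intro distr_PiM_reindex prob_space_axioms)
  show "(\<integral>w. F (\<lambda>i\<in>I. w (r i)) \<partial>prod_law K) = integral\<^sup>L (prod_law I) F"
    using integral_distr[OF T assms(3)] unfolding D by simp
  show "integrable (prod_law K) (\<lambda>w. F (\<lambda>i\<in>I. w (r i))) \<longleftrightarrow> integrable (prod_law I) F"
    using integrable_distr_eq[OF T assms(3)] unfolding D by simp
qed

text \<open>Given the shared observation the two kernels are independent with the same conditional
  mean, so their covariance is the variance of that mean. Fubini is applied twice: first to the
  fresh sample, then to the rest of the first sample.\<close>

lemma zeta1_lin_kernel:
  assumes m: "0 < m"
  shows "zeta1 P m (lin_kernel W m x) =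
    (\<integral>z. (hajek_proj W m z - integral\<^sup>L (prod_law {0..<m}) (lin_kernel W m x))\<^sup>2 \<partial>P)"
proof -
  let ?g = "lin_kernel W m x" and ?h = "hajek_proj W m"
  let ?I = "{0..<m}" and ?J = "{m..<2 * m}" and ?K = "{0..<2 * m}"
  define E where "E = integral\<^sup>L (prod_law ?I) ?g"
  \<comment> \<open>\<open>r\<close> places the second sample on the coordinates prescribed by
    \<open>zeta1\<close>; \<open>A\<close> and \<open>B\<close> restrict to \<open>m\<close>
    coordinates so that \<open>prod_law_reindex\<close> applies.\<close>
  define r where "r i = (if i = 0 then 0 else m + i)" for i :: nat
  define A where "A w = ?g (\<lambda>i\<in>?I. w i)" for w
  define B where "B w = ?g (\<lambda>i\<in>?I. w (r i))" for w
  interpret I: prob_space "prod_law ?I" by (rule prob_space_prod_law)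
  interpret J: prob_space "prod_law ?J" by (rule prob_space_prod_law)
  have r: "inj_on r ?I" "r \<in> ?I \<rightarrow> ?K"
    by (auto simp: r_def inj_on_def)
  have id: "inj_on (\<lambda>i. i) ?I" "(\<lambda>i. i) \<in> ?I \<rightarrow> ?K"
    by auto
  have sub [measurable]: "(\<lambda>w. \<lambda>i\<in>?I. w i) \<in> measurable (prod_law ?K) (prod_law ?I)"
    "(\<lambda>w. \<lambda>i\<in>?I. w (r i)) \<in> measurable (prod_law ?K) (prod_law ?I)"
    using r by (intro measurable_restrict measurable_component_singleton; auto)+
  have AB_meas [measurable]: "A \<in> borel_measurable (prod_law ?K)" "B \<in> borel_measurable (prod_law ?K)"
    unfolding A_def[abs_def] B_def[abs_def]
    by (rule measurable_compose[OF sub(1) measurable_lin_kernel],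
        rule measurable_compose[OF sub(2) measurable_lin_kernel])
  have g_A: "?g w = A w" for w
    unfolding A_def by (rule lin_kernel_cong) simp
  have g_B: "?g (\<lambda>i. if i = 0 then w 0 else w (m + i)) = B w" for w
    unfolding B_def by (rule lin_kernel_cong) (simp add: r_def)
  have EA: "integral\<^sup>L (prod_law ?K) A = E" and EB: "integral\<^sup>L (prod_law ?K) B = E"
    unfolding A_def[abs_def] B_def[abs_def] E_def
    using prod_law_reindex(1)[OF id measurable_lin_kernel] prod_law_reindex(1)[OF r measurable_lin_kernel]
    by simp_all
  have g_int: "integrable (prod_law ?I) (\<lambda>w. (?g w - E)\<^sup>2)"
    using integrable_add_square[of ?g "prod_law ?I" "\<lambda>_. - E"] lin_kernel_square_integrable
    by simp
  have g_meas: "(\<lambda>w. (?g w - E)\<^sup>2) \<in> borel_measurable (prod_law ?I)"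
    by measurable
  have AB_int: "integrable (prod_law ?K) (\<lambda>w. (A w - E)\<^sup>2)" "integrable (prod_law ?K) (\<lambda>w. (B w - E)\<^sup>2)"
    unfolding A_def B_def
    using prod_law_reindex(2)[OF id g_meas] prod_law_reindex(2)[OF r g_meas] g_int by simp_all
  have prod_int: "integrable (prod_law ?K) (\<lambda>w. (A w - E) * (B w - E))"
    by (rule integrable_mult_of_squares) (simp_all add: AB_int)
  have K: "?I \<union> ?J = ?K" by auto
  have "zeta1 P m ?g = (\<integral>w. (A w - E) * (B w - E) \<partial>prod_law ?K)"
    unfolding zeta1_def Let_def g_B EB by (simp add: g_A[abs_def] EA)
  also have "\<dots> = (\<integral>a. (\<integral>b. (A (merge ?I ?J (a, b)) - E) * (B (merge ?I ?J (a, b)) - E) \<partial>prod_law ?J) \<partial>prod_law ?I)"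
    using product_integral_fold[of ?I ?J "\<lambda>w. (A w - E) * (B w - E)"] prod_int unfolding K by simp
  also have "\<dots> = (\<integral>a. (?g a - E) * (?h (a 0) - E) \<partial>prod_law ?I)"
  proof (rule Bochner_Integration.integral_cong[OF refl])
    fix a :: "nat \<Rightarrow> 'a \<times> real"
    define G where "G b = ?g (b(0 := a 0))" for b
    \<comment> \<open>Shifting indices by \<open>m\<close> turns the integral over the fresh sample
      into the one that defines \<open>hajek_proj\<close>.\<close>
    let ?S = "\<lambda>b :: nat \<Rightarrow> 'a \<times> real. \<lambda>i\<in>{Suc 0..<m}. b (m + i)"
    have shift: "inj_on (\<lambda>i. m + i) {Suc 0..<m}" "(\<lambda>i. m + i) \<in> {Suc 0..<m} \<rightarrow> ?J"
      by auto
    have G_meas: "G \<in> borel_measurable (prod_law {Suc 0..<m})"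
      unfolding G_def[abs_def] by (rule measurable_kernel_update_0[OF m])
    have G_int: "integrable (prod_law ?J) (\<lambda>b. G (?S b))"
      using prod_law_reindex(2)[OF shift G_meas] kernel_update_0_integrable[OF m, of W "a 0"]
      by (simp add: G_def[abs_def])
    have G_eq: "(\<integral>b. G (?S b) \<partial>prod_law ?J) = ?h (a 0)"
      using prod_law_reindex(1)[OF shift G_meas] by (simp add: G_def[abs_def] hajek_proj_def)
    have A_eq: "A (merge ?I ?J (a, b)) = ?g a" for b
      unfolding A_def by (rule lin_kernel_cong) (simp add: merge_def)
    have B_eq: "B (merge ?I ?J (a, b)) = G (?S b)" for b
      unfolding B_def G_def using m by (intro lin_kernel_cong) (auto simp: merge_def r_def)
    show "(\<integral>b. (A (merge ?I ?J (a, b)) - E) * (B (merge ?I ?J (a, b)) - E) \<partial>prod_law ?J) =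
        (?g a - E) * (?h (a 0) - E)"
      unfolding A_eq B_eq using G_int G_eq by (simp add: J.prob_space)
  qed
  \<comment> \<open>With observation 0 outermost, the projection factor is constant in the inner
    integral, which averages the remaining kernel to \<open>?h z\<close>.\<close>
  also have "\<dots> = (\<integral>z. (\<integral>w. (?g (w(0 := z)) - E) * (?h z - E) \<partial>prod_law {Suc 0..<m}) \<partial>P)"
  proof -
    have 0: "insert 0 {Suc 0..<m} = ?I" using m by auto
    have [measurable]: "0 \<in> ?I" using m by simp
    note [measurable] = hajek_proj_measurable[OF m, of W]
    have h_int: "integrable P (\<lambda>z. (?h z - E)\<^sup>2)"
      using integrable_add_square[of ?h P "\<lambda>_. - E"] hajek_proj_square_integrable[OF m] by simp
    have D: "distr (prod_law ?I) P (\<lambda>w. w 0) = P"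
      using m by (intro distr_PiM_component prob_space_axioms) auto
    have "integrable (distr (prod_law ?I) P (\<lambda>w. w 0)) (\<lambda>z. (?h z - E)\<^sup>2)"
      unfolding D by (rule h_int)
    then have "integrable (prod_law ?I) (\<lambda>a. (?h (a 0) - E)\<^sup>2)"
      by (subst (asm) integrable_distr_eq) measurable
    then have "integrable (prod_law ?I) (\<lambda>a. (?g a - E) * (?h (a 0) - E))"
      by (intro integrable_mult_of_squares[OF _ _ g_int]) measurable
    then have "integrable (prod_law (insert 0 {Suc 0..<m})) (\<lambda>a. (?g a - E) * (?h (a 0) - E))"
      unfolding 0 .
    from product_integral_insert_rev[OF _ _ this] show ?thesis
      unfolding 0 by simp
  qed
  also have "\<dots> = (\<integral>z. (?h z - E)\<^sup>2 \<partial>P)"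
  proof (rule Bochner_Integration.integral_cong[OF refl])
    fix z
    interpret R: prob_space "prod_law {Suc 0..<m}" by (rule prob_space_prod_law)
    show "(\<integral>w. (?g (w(0 := z)) - E) * (?h z - E) \<partial>prod_law {Suc 0..<m}) = (?h z - E)\<^sup>2"
      using kernel_update_0_integrable[OF m, of W z]
      by (simp add: R.prob_space hajek_proj_def power2_eq_square)
  qed
  finally show ?thesis unfolding E_def .
qed

lemma zeta1_lin_kernel_ge:
  assumes "0 < m"
  shows "v * (2 * (\<Sum>L\<in>Pow {0..<m} - {{}}. if 0 \<in> L then W L / real (card L + m) else 0) -
    1 / real (2 * m + 1)) \<le> zeta1 P m (lin_kernel W m x)"
  unfolding zeta1_lin_kernel[OF assms]
  using v_pos
  by (intro order_trans[OF mult_left_mono[OF proj_slope_square_ge] hajek_proj_variance_ge] assms) simp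

end

subsection \<open>Weights of the two-scale kernel\<close>

text \<open>The coefficient \<alpha> is spread evenly over the subsamples of size \<open>s\<close>
  and \<beta> sits on the full sample. A single DNN kernel is the case \<alpha> = 0, \<beta> =
  1.\<close>

definition mixture_weight :: "real \<Rightarrow> real \<Rightarrow> nat \<Rightarrow> nat \<Rightarrow> nat set \<Rightarrow> real" where
  "mixture_weight \<alpha> \<beta> s m L =
    \<alpha> * of_bool (card L = s) / real (m choose s) + \<beta> * of_bool (L = {0..<m})"

text \<open>\<open>F\<close> is arbitrary because three choices are needed: nearest-neighbour values
  for the kernel, the constant 1 for the total weight, and reciprocals for the moments.\<close>

lemma sum_mixture_weight:
  assumes "0 < s" "s \<le> m"
  shows "(\<Sum>L\<in>Pow {0..<m} - {{}}. mixture_weight \<alpha> \<beta> s m L * F L) =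
    \<alpha> * ((\<Sum>L\<in>{L. L \<subseteq> {0..<m} \<and> card L = s}. F L) / real (m choose s)) + \<beta> * F {0..<m}"
proof -
  let ?S = "Pow {0..<m} - {{}}"
  have fin: "finite ?S" by simp
  have "(\<Sum>L\<in>?S. of_bool (card L = s) * F L) = (\<Sum>L\<in>{L \<in> ?S. card L = s}. F L)"
    by (rule trans[OF sum.cong[OF refl] sum.inter_filter[OF fin, symmetric]]) auto
  also have "{L \<in> ?S. card L = s} = {L. L \<subseteq> {0..<m} \<and> card L = s}"
    using assms by auto
  finally have 1: "(\<Sum>L\<in>?S. of_bool (card L = s) * F L) = (\<Sum>L\<in>{L. L \<subseteq> {0..<m} \<and> card L = s}. F L)" .
  have "(\<Sum>L\<in>?S. of_bool (L = {0..<m}) * F L) = (\<Sum>L\<in>?S. if L = {0..<m} then F L else 0)"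
    by (intro sum.cong) auto
  also have "\<dots> = F {0..<m}"
    using assms by (subst sum.delta[OF fin]) auto
  finally have 2: "(\<Sum>L\<in>?S. of_bool (L = {0..<m}) * F L) = F {0..<m}" .
  have "(\<Sum>L\<in>?S. mixture_weight \<alpha> \<beta> s m L * F L) =
      (\<Sum>L\<in>?S. \<alpha> / real (m choose s) * (of_bool (card L = s) * F L) + \<beta> * (of_bool (L = {0..<m}) * F L))"
    by (intro sum.cong) (auto simp: mixture_weight_def algebra_simps)
  also have "\<dots> = \<alpha> / real (m choose s) * (\<Sum>L\<in>?S. of_bool (card L = s) * F L) +
      \<beta> * (\<Sum>L\<in>?S. of_bool (L = {0..<m}) * F L)"
    by (simp only: sum.distrib sum_distrib_left)
  finally show ?thesis unfolding 1 2 by simp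
qed

lemma lin_kernel_mixture:
  assumes "0 < s" "s \<le> m"
  shows "lin_kernel (mixture_weight \<alpha> \<beta> s m) m x z = \<alpha> * dnn_est s m x z + \<beta> * dnn_kernel m x z"
  unfolding lin_kernel_def sum_mixture_weight[OF assms] dnn_est_def dnn_kernel_def ..

lemma total_weight_mixture_le:
  assumes "0 < s" "s \<le> m"
  shows "total_weight (mixture_weight \<alpha> \<beta> s m) m \<le> \<bar>\<alpha>\<bar> + \<bar>\<beta>\<bar>"
proof -
  have "total_weight (mixture_weight \<alpha> \<beta> s m) m \<le>
      (\<Sum>L\<in>Pow {0..<m} - {{}}. mixture_weight \<bar>\<alpha>\<bar> \<bar>\<beta>\<bar> s m L * 1)"
    unfolding mixture_weight_def by (intro sum_mono) (auto intro: order_trans[OF abs_triangle_ineq])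
  also have "\<dots> = \<bar>\<alpha>\<bar> + \<bar>\<beta>\<bar>"
    using assms by (subst sum_mixture_weight) (simp_all add: n_subsets)
  finally show ?thesis .
qed

lemma card_subsets_containing_0:
  assumes "0 < s" "s \<le> m"
  shows "card {L. L \<subseteq> {0..<m} \<and> card L = s \<and> 0 \<in> L} = (m - 1) choose (s - 1)"
proof -
  have "{L. L \<subseteq> {0..<m} \<and> card L = s \<and> 0 \<in> L} = insert 0 ` {B. B \<subseteq> {Suc 0..<m} \<and> card B = s - 1}"
    (is "?A = insert 0 ` ?B")
  proof (intro equalityI subsetI)
    fix L assume L: "L \<in> ?A"
    then have "L - {0} \<in> ?B" "L = insert 0 (L - {0})"
      by (auto simp: subset_iff Suc_le_eq)
    then show "L \<in> insert 0 ` ?B" by blast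
  next
    fix L assume "L \<in> insert 0 ` ?B"
    then obtain B where B: "B \<subseteq> {Suc 0..<m}" "card B = s - 1" "L = insert 0 B" by auto
    then have "finite B" "0 \<notin> B" by (auto intro: finite_subset)
    then have "card L = s" using B assms by simp
    then show "L \<in> ?A" using B assms by auto
  qed
  moreover have "inj_on (insert 0) ?B"
    by (rule inj_on_inverseI[where g = "\<lambda>L. L - {0}"]) auto
  ultimately have "card ?A = card ?B" by (simp add: card_image)
  then show ?thesis by (simp add: n_subsets)
qed

text \<open>The chance that a uniformly chosen \<open>s\<close>-subset contains a given
  index.\<close>

lemma choose_ratio:
  assumes "0 < s" "s \<le> m"
  shows "real ((m - 1) choose (s - 1)) / real (m choose s) = real s / real m"
proof -
  obtain k l where "s = Suc k" "m = Suc l" using assms by (cases s; cases m) auto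
  then have "real s * real (m choose s) = real m * real ((m - 1) choose (s - 1))"
    by (metis Suc_times_binomial diff_Suc_1 of_nat_mult)
  moreover have "real (m choose s) \<noteq> 0" "real m \<noteq> 0" using assms by auto
  ultimately show ?thesis by (simp add: field_simps)
qed

text \<open>Since \<open>\<alpha> \<le> 0\<close>, replacing \<open>s / (s + m)\<close> by \<open>1 / 2\<close> only decreases the sum, and the weights
  then add up to 1.\<close>
lemma mixture_moment_ge:
  assumes s: "0 < s" "s \<le> m" and \<alpha>: "\<alpha> \<le> 0" and \<beta>: "\<alpha> + \<beta> = 1"
  shows "1 / (2 * real m) \<le>
    (\<Sum>L\<in>Pow {0..<m} - {{}}. if 0 \<in> L then mixture_weight \<alpha> \<beta> s m L / real (card L + m) else 0)"
proof -
  let ?F = "\<lambda>L. if 0 \<in> L then 1 / real (card L + m) else 0"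
  let ?T = "{L. L \<subseteq> {0..<m} \<and> card L = s}"
  have fin: "finite ?T" by (rule finite_subset[of _ "Pow {0..<m}"]) auto
  have "(\<Sum>L\<in>?T. ?F L) = (\<Sum>L\<in>?T. if 0 \<in> L then 1 / real (s + m) else 0)"
    by (intro sum.cong) auto
  also have "\<dots> = (\<Sum>L\<in>{L \<in> ?T. 0 \<in> L}. 1 / real (s + m))"
    by (rule sum.inter_filter[OF fin, symmetric])
  also have "{L \<in> ?T. 0 \<in> L} = {L. L \<subseteq> {0..<m} \<and> card L = s \<and> 0 \<in> L}" by auto
  finally have T: "(\<Sum>L\<in>?T. ?F L) = real ((m - 1) choose (s - 1)) * (1 / real (s + m))"
    by (simp add: card_subsets_containing_0[OF s])
  have "(\<Sum>L\<in>Pow {0..<m} - {{}}. if 0 \<in> L then mixture_weight \<alpha> \<beta> s m L / real (card L + m) else 0) =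
      (\<Sum>L\<in>Pow {0..<m} - {{}}. mixture_weight \<alpha> \<beta> s m L * ?F L)"
    by (intro sum.cong) auto
  also have "\<dots> = \<alpha> * (real s / real m * (1 / real (s + m))) + \<beta> * (1 / (2 * real m))"
    using s unfolding sum_mixture_weight[OF s] T choose_ratio[OF s, symmetric] by simp
  also have "\<dots> \<ge> \<alpha> * (1 / (2 * real m)) + \<beta> * (1 / (2 * real m))"
  proof (intro add_right_mono mult_left_mono_neg \<alpha>)
    have "real s / real (s + m) * (1 / real m) \<le> 1 / 2 * (1 / real m)"
      using s by (intro mult_right_mono) (simp_all add: field_simps)
    then show "real s / real m * (1 / real (s + m)) \<le> 1 / (2 * real m)"
      by (simp add: mult.commute)
  qed
  finally show ?thesis
    by (simp add: add_divide_distrib[symmetric] \<beta>)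
qed

section \<open>A bound on the variance ratio uniform in the subsampling sizes\<close>

context regression_law
begin

text \<open>The right-hand side is free of \<open>s\<close> and \<open>m\<close>: the total weight
  controls the numerator, and the noise keeps \<open>m * zeta1\<close> at least
  \<open>v / 2\<close>.\<close>

lemma hajek_ratio_bound:
  assumes s: "0 < s" "s \<le> m" and \<alpha>: "\<alpha> \<le> 0" "- C \<le> \<alpha>" and \<beta>: "\<alpha> + \<beta> = 1"
    and g: "\<And>z. g z = \<alpha> * dnn_est s m x z + \<beta> * dnn_kernel m x z"
  shows "\<bar>zetam P m g / (real m * zeta1 P m g) - 1\<bar> \<le> (1 + 2 * C)\<^sup>2 * M / (v / 2) + 1"
proof -
  let ?W = "mixture_weight \<alpha> \<beta> s m"
  let ?D = "(1 + 2 * C)\<^sup>2 * M"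
  have m: "0 < m" using s by simp
  have g_eq: "g = lin_kernel ?W m x"
    by (rule ext) (simp add: g lin_kernel_mixture[OF s])
  \<comment> \<open>The absolute value of \<alpha> is at most \<open>C\<close>, and \<beta> = 1 -
    \<alpha> lies between 1 and \<open>1 + C\<close>.\<close>
  have "total_weight ?W m \<le> 1 + 2 * C"
    using total_weight_mixture_le[OF s, of \<alpha> \<beta>] \<alpha> \<beta> by linarith
  then have "(total_weight ?W m)\<^sup>2 * M \<le> ?D"
    by (intro mult_right_mono power_mono M_nonneg sum_nonneg) auto
  then have upper: "zetam P m g \<le> ?D"
    unfolding g_eq using zetam_lin_kernel_le order_trans by blast
  \<comment> \<open>Since \<open>2 * m + 1\<close> exceeds \<open>2 * m\<close>, the subtracted
    moment costs at most one of the two copies of \<open>1 / (2 * m)\<close>.\<close>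
  have "1 / (2 * real m) \<le> 2 * (1 / (2 * real m)) - 1 / real (2 * m + 1)"
    using m frac_le[of 1 1 "2 * real m" "real (2 * m + 1)"] by simp
  also have "\<dots> \<le> 2 * (\<Sum>L\<in>Pow {0..<m} - {{}}. if 0 \<in> L then ?W L / real (card L + m) else 0) - 1 / real (2 * m + 1)"
    by (intro diff_right_mono mult_left_mono mixture_moment_ge s \<alpha> \<beta>) simp
  finally have "v * (1 / (2 * real m)) \<le> zeta1 P m g"
    unfolding g_eq using zeta1_lin_kernel_ge[OF m, of ?W] v_pos
    by (meson mult_left_mono order_trans less_imp_le)
  then have lower: "v / 2 \<le> real m * zeta1 P m g"
    using m by (simp add: field_simps)
  have nonneg: "0 \<le> zetam P m g"
    by (simp add: zetam_def Let_def)
  have "zetam P m g / (real m * zeta1 P m g) \<le> ?D / (v / 2)"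
    using upper lower nonneg v_pos by (intro frac_le) auto
  moreover have "0 \<le> zetam P m g / (real m * zeta1 P m g)"
    using lower nonneg v_pos by (intro divide_nonneg_nonneg) auto
  ultimately show ?thesis by linarith
qed

end

text \<open>\<open>P_law\<close> describes \<open>P\<close> on sets. Recognising \<open>P\<close> as
  the covariate law bound to a kernel extends this to integrals of nonnegative functions.\<close>

lemma nn_integral_kernel_law:
  fixes P :: "('a::euclidean_space \<times> real) measure"
  assumes f: "continuous_on UNIV f" and X: "X \<in> sets borel"
    and K: "K \<in> measurable lborel (prob_algebra borel)"
    and P_sets: "sets P = sets borel"
    and P_law: "\<And>A. A \<in> sets (borel :: ('a \<times> real) measure) \<Longrightarrow>
         emeasure P A = (\<integral>\<^sup>+ u. ennreal (f u) * indicator X u * emeasure (K u) (Pair u -` A) \<partial>lborel)"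
    and F: "F \<in> borel_measurable borel"
  shows "(\<integral>\<^sup>+ z. F z \<partial>P) = (\<integral>\<^sup>+ u. ennreal (f u) * indicator X u * (\<integral>\<^sup>+ y. F (u, y) \<partial>K u) \<partial>lborel)"
proof -
  have [measurable]: "f \<in> borel_measurable borel"
    using f by (rule borel_measurable_continuous_onI)
  note [measurable] = X
  define d where "d u = ennreal (f u) * indicator X u" for u
  have d [measurable]: "d \<in> borel_measurable lborel"
    unfolding d_def[abs_def] by measurable
  define N where "N = density lborel d"
  \<comment> \<open>The conditional law of the whole pair: a point mass at \<open>u\<close> in the
    covariate, and \<open>K u\<close> in the response.\<close>
  define R where "R u = distr (K u) (borel :: ('a \<times> real) measure) (Pair u)" for u
  have K_sub: "K \<in> measurable lborel (subprob_algebra borel)"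
    using K by (rule measurable_prob_algebraD)
  have pair: "(\<lambda>(u, y). (u, y)) \<in> measurable (lborel \<Otimes>\<^sub>M borel) (borel :: ('a \<times> real) measure)"
    unfolding borel_prod[symmetric] by measurable
  have R: "R \<in> measurable lborel (subprob_algebra borel)"
    unfolding R_def[abs_def] by (rule measurable_distr2[OF pair K_sub])
  have R_N: "R \<in> measurable N (subprob_algebra borel)"
    unfolding N_def using R by (simp cong: measurable_cong_sets)
  have K_sets: "sets (K u) = sets borel" for u
    using K_sub by (rule sets_kernel) simp
  have Pair: "Pair u \<in> measurable (K u) (borel :: ('a \<times> real) measure)" for u
    unfolding borel_prod[symmetric] measurable_cong_sets[OF K_sets refl] by measurable
  have "P = N \<bind> R"
  proof (rule measure_eqI)
    show "sets P = sets (N \<bind> R)"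
      by (subst sets_bind[OF sets_kernel[OF R_N]]) (simp_all add: P_sets N_def)
    fix A assume "A \<in> sets P"
    then have A: "A \<in> sets (borel :: ('a \<times> real) measure)" by (simp add: P_sets)
    have RA: "emeasure (R u) A = emeasure (K u) (Pair u -` A)" for u
      unfolding R_def using A Pair[of u] sets_eq_imp_space_eq[OF K_sets[of u]]
      by (simp add: emeasure_distr)
    have "emeasure (N \<bind> R) A = (\<integral>\<^sup>+ u. emeasure (R u) A \<partial>N)"
      by (rule emeasure_bind[OF _ R_N A]) (simp add: N_def)
    also have "\<dots> = (\<integral>\<^sup>+ u. d u * emeasure (R u) A \<partial>lborel)"
      unfolding N_def
      by (rule nn_integral_density[OF d measurable_emeasure_kernel[OF R A]])
    finally show "emeasure P A = emeasure (N \<bind> R) A"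
      by (simp add: P_law[OF A] RA d_def)
  qed
  then have "(\<integral>\<^sup>+ z. F z \<partial>P) = (\<integral>\<^sup>+ u. (\<integral>\<^sup>+ z. F z \<partial>R u) \<partial>N)"
    using nn_integral_bind[OF F R_N] by simp
  also have "\<dots> = (\<integral>\<^sup>+ u. d u * (\<integral>\<^sup>+ z. F z \<partial>R u) \<partial>lborel)"
    unfolding N_def
    by (rule nn_integral_density[OF d])
      (rule measurable_compose[OF R nn_integral_measurable_subprob_algebra[OF F]])
  also have "\<dots> = (\<integral>\<^sup>+ u. d u * (\<integral>\<^sup>+ y. F (u, y) \<partial>K u) \<partial>lborel)"
    unfolding R_def using F by (simp add: nn_integral_distr[OF Pair])
  finally show ?thesis by (simp add: d_def)
qed

subsection \<open>The regression model\<close>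

text \<open>Compactness supplies the constants: \<open>M\<close> is the maximum of
  \<open>\<sigma>2 + \<mu>\<^sup>2\<close>, the conditional second moment, and \<open>v\<close> is
  the minimum of \<open>\<sigma>2\<close>, positive because it is attained. Each locale assumption
  is then checked for fixed \<open>u\<close> and integrated.\<close>

lemma regression_law_of_kernel:
  fixes X :: "'a::euclidean_space set" and P :: "('a \<times> real) measure"
  assumes X_compact: "compact X"
    and f_cont: "continuous_on UNIV f"
    and \<mu>_cont: "continuous_on UNIV \<mu>"
    and K_kernel: "K \<in> measurable lborel (prob_algebra borel)"
    and P_sets: "sets P = sets (borel :: ('a \<times> real) measure)"
    and P_prob: "prob_space P"
    and P_law: "\<And>A. A \<in> sets (borel :: ('a \<times> real) measure) \<Longrightarrow>
         emeasure P A = (\<integral>\<^sup>+ u. ennreal (f u) * indicator X u * emeasure (K u) (Pair u -` A) \<partial>lborel)"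
    and \<mu>_L2: "integrable P (\<lambda>z. (\<mu> (fst z))\<^sup>2)"
    and noise_integrable: "\<And>u. u \<in> X \<Longrightarrow> integrable (K u) (\<lambda>y. y\<^sup>2)"
    and noise_mean: "\<And>u. u \<in> X \<Longrightarrow> integral\<^sup>L (K u) (\<lambda>y. y) = \<mu> u"
    and noise_var: "\<And>u. u \<in> X \<Longrightarrow> integral\<^sup>L (K u) (\<lambda>y. (y - \<mu> u)\<^sup>2) = \<sigma>2 u"
    and \<sigma>2_cont: "continuous_on X \<sigma>2"
    and \<sigma>2_pos: "\<And>u. u \<in> X \<Longrightarrow> 0 < \<sigma>2 u"
    and x_in: "x \<in> X"
  shows "\<exists>M v. regression_law P x \<mu> M v"
proof -
  have X_borel [measurable]: "X \<in> sets borel"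
    using X_compact by (intro borel_closed compact_imp_closed)
  have \<mu>_meas [measurable]: "\<mu> \<in> borel_measurable borel"
    using \<mu>_cont by (rule borel_measurable_continuous_onI)
  have f_meas [measurable]: "f \<in> borel_measurable borel"
    using f_cont by (rule borel_measurable_continuous_onI)
  have K_space: "K u \<in> space (prob_algebra borel)" for u
    using measurable_space[OF K_kernel] by simp
  then have K_sets [measurable_cong]: "sets (K u) = sets borel" and K_prob: "prob_space (K u)" for u
    by (auto simp: space_prob_algebra)
  have K_one: "emeasure (K u) (space (K u)) = 1" for u
    using K_prob by (rule prob_space.emeasure_space_1)
  have Y_int: "integrable (K u) (\<lambda>y. y)" if "u \<in> X" for u
  proof -
    interpret Ku: prob_space "K u" by (rule K_prob)
    show ?thesis
      by (rule Ku.square_integrable_imp_integrable[OF _ noise_integrable[OF that]]) measurable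
  qed
  have sq_int: "integrable (K u) (\<lambda>y. (y - \<mu> u)\<^sup>2)" if "u \<in> X" for u
    unfolding power2_diff using noise_integrable[OF that] Y_int[OF that] prob_space.finite_measure[OF K_prob]
    by (intro Bochner_Integration.integrable_add Bochner_Integration.integrable_diff integrable_mult_left
        integrable_mult_right finite_measure.integrable_const)
  have second: "(\<integral>y. y\<^sup>2 \<partial>K u) = \<sigma>2 u + (\<mu> u)\<^sup>2" if "u \<in> X" for u
  proof -
    interpret Ku: prob_space "K u" by (rule K_prob)
    have "\<sigma>2 u = (\<integral>y. y\<^sup>2 - 2 * \<mu> u * y + (\<mu> u)\<^sup>2 \<partial>K u)"
      unfolding noise_var[OF that, symmetric]
      by (intro Bochner_Integration.integral_cong) (auto simp: power2_diff)
    also have "\<dots> = (\<integral>y. y\<^sup>2 \<partial>K u) - 2 * \<mu> u * \<mu> u + (\<mu> u)\<^sup>2"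
      using noise_integrable[OF that] Y_int[OF that] by (simp add: noise_mean[OF that] Ku.prob_space)
    finally show ?thesis by (simp add: power2_eq_square)
  qed
  have "continuous_on X (\<lambda>u. \<sigma>2 u + (\<mu> u)\<^sup>2)"
    by (intro continuous_intros \<sigma>2_cont continuous_on_subset[OF \<mu>_cont]) auto
  from continuous_attains_sup[OF X_compact _ this] x_in
  obtain uM where uM: "uM \<in> X" "\<And>u. u \<in> X \<Longrightarrow> \<sigma>2 u + (\<mu> u)\<^sup>2 \<le> \<sigma>2 uM + (\<mu> uM)\<^sup>2"
    by blast
  from continuous_attains_inf[OF X_compact _ \<sigma>2_cont] x_in
  obtain uv where uv: "uv \<in> X" "\<And>u. u \<in> X \<Longrightarrow> \<sigma>2 uv \<le> \<sigma>2 u"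
    by blast
  define M where "M = \<sigma>2 uM + (\<mu> uM)\<^sup>2"
  define v where "v = \<sigma>2 uv"
  have M_nonneg: "0 \<le> M" using \<sigma>2_pos[OF uM(1)] by (simp add: M_def)
  have v_pos: "0 < v" using \<sigma>2_pos[OF uv(1)] by (simp add: v_def)
  have law': "(\<integral>\<^sup>+ z. F z \<partial>P) = (\<integral>\<^sup>+ u. ennreal (f u) * indicator X u * (\<integral>\<^sup>+ y. F (u, y) \<partial>K u) \<partial>lborel)"
    if "F \<in> borel_measurable (borel \<Otimes>\<^sub>M borel)" for F :: "'a \<times> real \<Rightarrow> ennreal"
    using that unfolding borel_prod
    by (intro nn_integral_kernel_law[OF f_cont X_borel K_kernel P_sets] P_law)
  have "regression_law P x \<mu> M v"
  proof (rule regression_law.intro[OF P_prob], unfold_locales)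
    fix r
    have "closed {z :: 'a \<times> real. dist (fst z) x = r}"
      by (intro closed_Collect_eq continuous_intros)
    then have "emeasure P {z. dist (fst z) x = r} =
        (\<integral>\<^sup>+ u. ennreal (f u) * indicator X u * emeasure (K u) (Pair u -` {z. dist (fst z) x = r}) \<partial>lborel)"
      by (intro P_law borel_closed)
    also have "\<dots> = (\<integral>\<^sup>+ u. 0 \<partial>(lborel :: 'a measure))"
    proof (rule nn_integral_cong_AE)
      \<comment> \<open>Off this sphere the fibre over \<open>u\<close> is empty, so the integrand
        vanishes almost everywhere.\<close>
      have "sphere x r \<in> null_sets lborel"
        using negligible_sphere[of x r]
        by (simp add: negligible_iff_null_sets null_sets_completion_iff)
      then have "AE u in lborel. u \<notin> sphere x r" by (rule AE_not_in)
      then show "AE u in lborel. ennreal (f u) * indicator X u *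
          emeasure (K u) (Pair u -` {z. dist (fst z) x = r}) = 0"
        by (rule eventually_mono) (auto simp: dist_commute)
    qed
    finally show "emeasure P {z. dist (fst z) x = r} = 0" by simp
  next
    fix h :: "'a \<Rightarrow> ennreal" assume [measurable]: "h \<in> borel_measurable borel"
    have h_law: "(\<integral>\<^sup>+ z. h (fst z) \<partial>P) = (\<integral>\<^sup>+ u. ennreal (f u) * indicator X u * h u \<partial>lborel)"
      by (rule trans[OF law']) (measurable, simp add: K_one)
    have "(\<integral>\<^sup>+ z. ennreal ((snd z)\<^sup>2) * h (fst z) \<partial>P) =
        (\<integral>\<^sup>+ u. ennreal (f u) * indicator X u * (\<integral>\<^sup>+ y. ennreal (y\<^sup>2) * h u \<partial>K u) \<partial>lborel)"
      by (rule trans[OF law']) measurable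
    also have "\<dots> \<le> (\<integral>\<^sup>+ u. ennreal M * (ennreal (f u) * indicator X u * h u) \<partial>lborel)"
    proof (rule nn_integral_mono)
      fix u
      show "ennreal (f u) * indicator X u * (\<integral>\<^sup>+ y. ennreal (y\<^sup>2) * h u \<partial>K u) \<le>
          ennreal M * (ennreal (f u) * indicator X u * h u)"
      proof (cases "u \<in> X")
        case True
        have "(\<integral>\<^sup>+ y. ennreal (y\<^sup>2) * h u \<partial>K u) = ennreal (\<sigma>2 u + (\<mu> u)\<^sup>2) * h u"
          using noise_integrable[OF True]
          by (subst nn_integral_multc, measurable) (simp add: nn_integral_eq_integral second[OF True])
        also have "\<dots> \<le> ennreal M * h u"
          using uM(2)[OF True] by (intro mult_right_mono ennreal_leI) (simp_all add: M_def)
        finally have "ennreal (f u) * (\<integral>\<^sup>+ y. ennreal (y\<^sup>2) * h u \<partial>K u) \<le> ennreal (f u) * (ennreal M * h u)"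
          by (rule mult_left_mono) simp
        then show ?thesis
          using True by (simp add: mult.left_commute)
      qed simp
    qed
    also have "\<dots> = ennreal M * (\<integral>\<^sup>+ u. ennreal (f u) * indicator X u * h u \<partial>lborel)"
      by (rule nn_integral_cmult) measurable
    also have "(\<integral>\<^sup>+ u. ennreal (f u) * indicator X u * h u \<partial>lborel) = (\<integral>\<^sup>+ z. h (fst z) \<partial>P)"
      by (rule h_law[symmetric])
    finally show "(\<integral>\<^sup>+ z. ennreal ((snd z)\<^sup>2) * h (fst z) \<partial>P) \<le> ennreal M * (\<integral>\<^sup>+ z. h (fst z) \<partial>P)" .
  next
    fix h :: "'a \<Rightarrow> ennreal" assume [measurable]: "h \<in> borel_measurable borel"
    have h_law: "(\<integral>\<^sup>+ z. h (fst z) \<partial>P) = (\<integral>\<^sup>+ u. ennreal (f u) * indicator X u * h u \<partial>lborel)"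
      by (rule trans[OF law']) (measurable, simp add: K_one)
    have "ennreal v * (\<integral>\<^sup>+ z. h (fst z) \<partial>P) =
        ennreal v * (\<integral>\<^sup>+ u. ennreal (f u) * indicator X u * h u \<partial>lborel)"
      by (subst h_law) (rule refl)
    also have "\<dots> = (\<integral>\<^sup>+ u. ennreal v * (ennreal (f u) * indicator X u * h u) \<partial>lborel)"
      by (rule nn_integral_cmult[symmetric]) measurable
    also have "\<dots> \<le> (\<integral>\<^sup>+ u. ennreal (f u) * indicator X u * (\<integral>\<^sup>+ y. ennreal ((y - \<mu> u)\<^sup>2) * h u \<partial>K u) \<partial>lborel)"
    proof (rule nn_integral_mono)
      fix u
      show "ennreal v * (ennreal (f u) * indicator X u * h u) \<le>
          ennreal (f u) * indicator X u * (\<integral>\<^sup>+ y. ennreal ((y - \<mu> u)\<^sup>2) * h u \<partial>K u)"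
      proof (cases "u \<in> X")
        case True
        have "ennreal v * h u \<le> ennreal (\<sigma>2 u) * h u"
          using uv(2)[OF True] by (intro mult_right_mono ennreal_leI) (simp_all add: v_def)
        also have "\<dots> = (\<integral>\<^sup>+ y. ennreal ((y - \<mu> u)\<^sup>2) * h u \<partial>K u)"
          using sq_int[OF True]
          by (subst nn_integral_multc, measurable) (simp add: nn_integral_eq_integral noise_var[OF True])
        finally have "ennreal (f u) * (ennreal v * h u) \<le> ennreal (f u) * (\<integral>\<^sup>+ y. ennreal ((y - \<mu> u)\<^sup>2) * h u \<partial>K u)"
          by (rule mult_left_mono) simp
        then show ?thesis
          using True by (simp add: mult.left_commute)
      qed simp
    qed
    also have "\<dots> = (\<integral>\<^sup>+ z. ennreal ((snd z - \<mu> (fst z))\<^sup>2) * h (fst z) \<partial>P)"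
      by (rule sym, rule trans[OF law']) measurable
    finally show "ennreal v * (\<integral>\<^sup>+ z. h (fst z) \<partial>P) \<le>
        (\<integral>\<^sup>+ z. ennreal ((snd z - \<mu> (fst z))\<^sup>2) * h (fst z) \<partial>P)" .
  next
    fix k :: "'a \<Rightarrow> real" assume [measurable]: "k \<in> borel_measurable borel"
    let ?F = "\<lambda>u y. k u * (y - \<mu> u)"
    \<comment> \<open>Conditional centring is phrased as equality of the positive and negative
      parts, which can be integrated over \<open>u\<close> without an integrability
      condition.\<close>
    have eq: "(\<integral>\<^sup>+ y. ennreal (?F u y) \<partial>K u) = (\<integral>\<^sup>+ y. ennreal (- ?F u y) \<partial>K u)" if "u \<in> X" for u
    proof -
      interpret Ku: prob_space "K u" by (rule K_prob)
      have int: "integrable (K u) (?F u)" using Y_int[OF that] by simp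
      have zero: "(\<integral>y. ?F u y \<partial>K u) = 0"
        using Y_int[OF that] by (simp add: noise_mean[OF that] Ku.prob_space)
      obtain a b where ab: "0 \<le> a" "0 \<le> b" "(\<integral>\<^sup>+ y. ennreal (?F u y) \<partial>K u) = ennreal a"
        "(\<integral>\<^sup>+ y. ennreal (- ?F u y) \<partial>K u) = ennreal b" "integral\<^sup>L (K u) (?F u) = a - b"
        using int by (rule integrableE) auto
      then show ?thesis using zero by simp
    qed
    \<comment> \<open>If the product is not integrable, its Bochner integral is 0 by convention;
      otherwise it is the difference of two equal parts.\<close>
    show "(\<integral>z. k (fst z) * (snd z - \<mu> (fst z)) \<partial>P) = 0"
    proof (cases "integrable P (\<lambda>z. ?F (fst z) (snd z))")
      case True
      have "(\<integral>\<^sup>+ z. ennreal (?F (fst z) (snd z)) \<partial>P) =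
          (\<integral>\<^sup>+ u. ennreal (f u) * indicator X u * (\<integral>\<^sup>+ y. ennreal (?F u y) \<partial>K u) \<partial>lborel)"
        by (rule trans[OF law']) measurable
      also have "\<dots> = (\<integral>\<^sup>+ u. ennreal (f u) * indicator X u * (\<integral>\<^sup>+ y. ennreal (- ?F u y) \<partial>K u) \<partial>lborel)"
        by (intro nn_integral_cong) (auto simp: eq indicator_def)
      also have "\<dots> = (\<integral>\<^sup>+ z. ennreal (- ?F (fst z) (snd z)) \<partial>P)"
        by (rule sym, rule trans[OF law']) measurable
      finally show ?thesis
        using real_lebesgue_integral_def[OF True] by simp
    qed (simp add: not_integrable_integral_eq)
  qed (use P_sets \<mu>_L2 M_nonneg v_pos in auto)
  then show ?thesis by blast
qed

text \<open>A ratio at most \<open>1 - c\<close> raised to a negative power exceeds 1 by a fixed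
  margin, so the denominator is negative and bounded away from 0. The sign feeds
  \<open>mixture_moment_ge\<close>, the lower bound keeps the total weight bounded.\<close>

lemma tdnn_w1_bounds:
  assumes c: "0 < c" "c < 1 / 2" and k: "0 < k" and r: "c \<le> real s1 / real s2" "real s1 / real s2 \<le> 1 - c"
  shows "tdnn_w1 k s1 s2 \<le> 0" "- (1 / ((1 - c) powr (- 2 / real k) - 1)) \<le> tdnn_w1 k s1 s2"
proof -
  let ?r = "real s1 / real s2" and ?p = "- 2 / real k"
  have p: "?p < 0" using k by simp
  have "1 = 1 powr ?p" by simp
  also have "\<dots> < (1 - c) powr ?p"
    using c p by (intro powr_less_mono2_neg) auto
  finally have 1: "1 < (1 - c) powr ?p" .
  have 2: "(1 - c) powr ?p \<le> ?r powr ?p"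
    using c r p by (intro powr_mono2') auto
  have w: "tdnn_w1 k s1 s2 = - (1 / (?r powr ?p - 1))"
    unfolding tdnn_w1_def by (metis minus_diff_eq minus_divide_right)
  have "1 / (?r powr ?p - 1) \<le> 1 / ((1 - c) powr ?p - 1)"
    using 1 2 by (intro divide_left_mono) auto
  then show "- (1 / ((1 - c) powr ?p - 1)) \<le> tdnn_w1 k s1 s2"
    unfolding w by simp
  show "tdnn_w1 k s1 s2 \<le> 0"
    unfolding w using 1 2 by simp
qed

text \<open>The separate sequence \<open>t\<close> lets the order \<open>s1\<close> inherit its rate
  from \<open>s2\<close>.\<close>

lemma vanishing_times_bounded:
  fixes R :: "nat \<Rightarrow> real"
  assumes "(\<lambda>n. real (t n) / real n) \<longlonglongrightarrow> 0" "\<And>n. s n \<le> t n" "\<And>n. \<bar>R n\<bar> \<le> B"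
  shows "(\<lambda>n. real (s n) / real n * R n) \<longlonglongrightarrow> 0"
proof (rule tendsto_0_le[OF assms(1), where K = B])
  show "\<forall>\<^sub>F n in sequentially. norm (real (s n) / real n * R n) \<le> norm (real (t n) / real n) * B"
    using assms(2,3) by (intro always_eventually allI)
      (simp add: abs_mult, intro mult_mono divide_right_mono, auto)
qed

theorem theorem3:
  fixes \<X> :: "'a::euclidean_space set"
    and f \<mu> \<sigma>2 :: "'a \<Rightarrow> real"
    and K :: "'a \<Rightarrow> real measure"
    and P :: "('a \<times> real) measure"
    and f_lo f_hi \<sigma>2_hi \<cc> :: real
    and x :: 'a
    and s1 s2 :: "nat \<Rightarrow> nat"
  assumes X_compact: "compact \<X>"
    and f_bounds: "0 < f_lo" "f_lo \<le> f_hi" "\<And>u. u \<in> \<X> \<Longrightarrow> f_lo \<le> f u \<and> f u \<le> f_hi"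
    and f_smooth: "C4_bounded_higher f"
    and \<mu>_smooth: "C4_bounded_higher \<mu>"
    and K_kernel: "K \<in> measurable lborel (prob_algebra borel)"
    and P_sets: "sets P = sets (borel :: ('a \<times> real) measure)"
    and P_prob: "prob_space P"
    and P_law: "\<And>A. A \<in> sets (borel :: ('a \<times> real) measure) \<Longrightarrow>
         emeasure P A = (\<integral>\<^sup>+ u. ennreal (f u) * indicator \<X> u * emeasure (K u) (Pair u -` A) \<partial>lborel)"
    and \<mu>_L2: "integrable P (\<lambda>z. (\<mu> (fst z))\<^sup>2)"
    and noise_integrable: "\<And>u. u \<in> \<X> \<Longrightarrow> integrable (K u) (\<lambda>y. y\<^sup>2)"
    and noise_mean: "\<And>u. u \<in> \<X> \<Longrightarrow> integral\<^sup>L (K u) (\<lambda>y. y) = \<mu> u"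
    and noise_var: "\<And>u. u \<in> \<X> \<Longrightarrow> integral\<^sup>L (K u) (\<lambda>y. (y - \<mu> u)\<^sup>2) = \<sigma>2 u"
    and \<sigma>2_cont: "continuous_on \<X> \<sigma>2"
    and \<sigma>2_pos: "\<And>u. u \<in> \<X> \<Longrightarrow> 0 < \<sigma>2 u"
    and \<sigma>2_bdd: "\<And>u. u \<in> \<X> \<Longrightarrow> \<sigma>2 u \<le> \<sigma>2_hi"
    and \<sigma>2_L2: "integrable P (\<lambda>z. (\<sigma>2 (fst z))\<^sup>2)"
    and x_in: "x \<in> \<X>"
    and s_pos: "\<And>n. 0 < s1 n" and s_lt: "\<And>n. s1 n < s2 n" and s_le: "eventually (\<lambda>n. s2 n \<le> n) sequentially"
    and s2_o: "(\<lambda>n. real (s2 n) / real n) \<longlonglongrightarrow> 0"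
    and s1_inf: "filterlim s1 at_top sequentially"
    and s2_inf: "filterlim s2 at_top sequentially"
    and ratio: "0 < \<cc>" "\<cc> < 1/2"
        "\<And>n. \<cc> \<le> real (s1 n) / real (s2 n) \<and> real (s1 n) / real (s2 n) \<le> 1 - \<cc>"
  shows "((\<lambda>n. real (s1 n) / real n *
            (zetam P (s1 n) (dnn_kernel (s1 n) x) /
              (real (s1 n) * zeta1 P (s1 n) (dnn_kernel (s1 n) x)) - 1)) \<longlonglongrightarrow> 0) \<and>
         ((\<lambda>n. real (s2 n) / real n *
            (zetam P (s2 n) (dnn_kernel (s2 n) x) /
              (real (s2 n) * zeta1 P (s2 n) (dnn_kernel (s2 n) x)) - 1)) \<longlonglongrightarrow> 0) \<and>
         ((\<lambda>n. real (s2 n) / real n *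
            (zetam P (s2 n) (tdnn_kernel (s1 n) (s2 n) x) /
              (real (s2 n) * zeta1 P (s2 n) (tdnn_kernel (s1 n) (s2 n) x)) - 1)) \<longlonglongrightarrow> 0)"
proof -
  have cont: "continuous_on UNIV g" if "C4_bounded_higher g" for g :: "'a \<Rightarrow> real"
  proof -
    have "\<forall>vs. set vs \<subseteq> Basis \<and> length vs \<le> 4 \<longrightarrow> continuous_on UNIV (iter_partial vs g)"
      using that unfolding C4_bounded_higher_def by blast
    \<comment> \<open>The empty list of directions stands for the function itself.\<close>
    from this[rule_format, of "[]"] show ?thesis by simp
  qed
  obtain M v where "regression_law P x \<mu> M v"
    using regression_law_of_kernel[OF X_compact cont[OF f_smooth] cont[OF \<mu>_smooth] K_kernel P_sets
        P_prob P_law \<mu>_L2 noise_integrable noise_mean noise_var \<sigma>2_cont \<sigma>2_pos x_in] by blast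
  then interpret regression_law P x \<mu> M v .
  let ?C = "1 / ((1 - \<cc>) powr (- 2 / real DIM('a)) - 1)"
  \<comment> \<open>The pure DNN kernel is the mixture with both sizes equal to \<open>s\<close> and
    \<alpha> = 0, whence \<open>C = 0\<close>.\<close>
  have dnn: "\<bar>zetam P s (dnn_kernel s x) / (real s * zeta1 P s (dnn_kernel s x)) - 1\<bar> \<le>
      (1 + 2 * 0)\<^sup>2 * M / (v / 2) + 1" if "0 < s" for s
    by (rule hajek_ratio_bound[where s = s and \<alpha> = 0 and \<beta> = 1]) (use that in auto)
  \<comment> \<open>\<open>?C\<close> depends only on the ratio bound and the dimension, so a single
    bound serves all \<open>n\<close>.\<close>
  have tdnn: "\<bar>zetam P (s2 n) (tdnn_kernel (s1 n) (s2 n) x) /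
      (real (s2 n) * zeta1 P (s2 n) (tdnn_kernel (s1 n) (s2 n) x)) - 1\<bar> \<le>
      (1 + 2 * ?C)\<^sup>2 * M / (v / 2) + 1" for n
    using tdnn_w1_bounds[OF ratio(1,2), of "DIM('a)" "s1 n" "s2 n"] ratio(3)[of n] s_pos[of n] s_lt[of n]
    by (intro hajek_ratio_bound[where s = "s1 n" and \<alpha> = "tdnn_w1 DIM('a) (s1 n) (s2 n)"
          and \<beta> = "tdnn_w2 DIM('a) (s1 n) (s2 n)"])
      (auto simp: tdnn_kernel_def tdnn_w2_def)
  have pos: "0 < s2 n" for n using s_pos[of n] s_lt[of n] by linarith
  show ?thesis
  proof (intro conjI)
    show "(\<lambda>n. real (s1 n) / real n * (zetam P (s1 n) (dnn_kernel (s1 n) x) /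
        (real (s1 n) * zeta1 P (s1 n) (dnn_kernel (s1 n) x)) - 1)) \<longlonglongrightarrow> 0"
      by (rule vanishing_times_bounded[OF s2_o]) (rule less_imp_le[OF s_lt], rule dnn[OF s_pos])
    show "(\<lambda>n. real (s2 n) / real n * (zetam P (s2 n) (dnn_kernel (s2 n) x) /
        (real (s2 n) * zeta1 P (s2 n) (dnn_kernel (s2 n) x)) - 1)) \<longlonglongrightarrow> 0"
      by (rule vanishing_times_bounded[OF s2_o]) (rule order_refl, rule dnn[OF pos])
    show "(\<lambda>n. real (s2 n) / real n * (zetam P (s2 n) (tdnn_kernel (s1 n) (s2 n) x) /
        (real (s2 n) * zeta1 P (s2 n) (tdnn_kernel (s1 n) (s2 n) x)) - 1)) \<longlonglongrightarrow> 0"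
      by (rule vanishing_times_bounded[OF s2_o]) (rule order_refl, rule tdnn)
  qed
qed

end
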